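(* Let $\kappa>0$, $s\in[2,\tfrac52)$, and let $(u_0,\rho_0)\in H^s(0,\tfrac12)\times H^{s-1}(0,\tfrac12)$ with $u_0(0)=u_0(\tfrac12)=0$ and $\rho_0(0)=\rho_0(\tfrac12)=0$. Let $(u,\rho)$ be the solution of (IBVP-2HS) on its maximal interval $[0,T)$. Then $(u,\rho)$ does not blow up in $H^1(0,\tfrac12)\times L_2(0,\tfrac12)$ in finite time: for every finite $T'>0$, $$\sup_{t\in[0,T)\cap[0,T']}\Big(\|u(t)\|_{H^1(0,\frac12)}+\|\rho(t)\|_{L_2(0,\frac12)}\Big)<\infty.$$
   Context: $H^s(a,b)$ is the $L_2$-Sobolev space of order $s$ on $(a,b)$. For $\kappa>0$, the initial boundary value problem (IBVP-2HS) on $(0,\tfrac12)$ is $$m_t=-m_xu-2u_xm-\kappa\rho\rho_x,\quad m=-u_{xx},\quad \rho_t=-(\rho u)_x\qquad (t>0,\ x\in(0,\tfrac12)),$$ with $u(0,\cdot)=u_0$, $\rho(0,\cdot)=\rho_0$ on $[0,\tfrac12]$ and $u(t,0)=\rho(t,0)=u(t,\tfrac12)=\rho(t,\tfrac12)=0$ for all $t\ge0$. For such data with $s\in[2,\tfrac52)$ it has a unique solution on a maximal interval $[0,T)$ in $C([0,T);H^s\times H^{s-1})\cap C^1([0,T);H^{s-1}\times H^{s-2})$ over $(0,\tfrac12)$. *)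

theory Defs
  imports "HOL-Analysis.Analysis"
begin

definition Ival :: "real set" where
  "Ival = {0<..<1/2}"

definition L2_mem :: "(real \<Rightarrow> real) \<Rightarrow> bool" where
  "L2_mem f \<longleftrightarrow> set_borel_measurable lborel Ival f \<and>
                 set_integrable lborel Ival (\<lambda>x. (f x)^2)"

definition L2_norm :: "(real \<Rightarrow> real) \<Rightarrow> real" where
  "L2_norm f = sqrt (LINT x:Ival|lborel. (f x)^2)"

definition test_fun :: "(real \<Rightarrow> real) \<Rightarrow> bool" where
  "test_fun \<phi> \<longleftrightarrow> (\<forall>k x. (deriv ^^ k) \<phi> differentiable (at x)) \<and>
     (\<exists>a b. 0 < a \<and> a \<le> b \<and> b < 1/2 \<and> (\<forall>x. x \<notin> {a..b} \<longrightarrow> \<phi> x = 0))"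

definition weak_deriv :: "(real \<Rightarrow> real) \<Rightarrow> (real \<Rightarrow> real) \<Rightarrow> bool" where
  "weak_deriv f g \<longleftrightarrow> (\<forall>\<phi>. test_fun \<phi> \<longrightarrow>
     (LINT x:Ival|lborel. f x * deriv \<phi> x) = - (LINT x:Ival|lborel. g x * \<phi> x))"

definition gag_sq :: "real \<Rightarrow> (real \<Rightarrow> real) \<Rightarrow> ennreal" where
  "gag_sq \<sigma> f = (\<integral>\<^sup>+ p. indicator (Ival \<times> Ival) p *
      ennreal (\<bar>f (fst p) - f (snd p)\<bar>^2 / \<bar>fst p - snd p\<bar> powr (1 + 2*\<sigma>))
      \<partial>(lborel \<Otimes>\<^sub>M lborel))"

definition sob_chain :: "real \<Rightarrow> (real \<Rightarrow> real) \<Rightarrow> (nat \<Rightarrow> real \<Rightarrow> real) \<Rightarrow> bool" where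
  "sob_chain r f g \<longleftrightarrow>
     (\<forall>x\<in>Ival. g 0 x = f x) \<and>
     (\<forall>j\<le>nat \<lfloor>r\<rfloor>. L2_mem (g j)) \<and>
     (\<forall>j<nat \<lfloor>r\<rfloor>. weak_deriv (g j) (g (Suc j))) \<and>
     (frac r \<noteq> 0 \<longrightarrow> gag_sq (frac r) (g (nat \<lfloor>r\<rfloor>)) < \<infinity>)"

definition H_mem :: "real \<Rightarrow> (real \<Rightarrow> real) \<Rightarrow> bool" where
  "H_mem r f \<longleftrightarrow> 0 \<le> r \<and> (\<exists>g. sob_chain r f g)"

definition H_norm :: "real \<Rightarrow> (real \<Rightarrow> real) \<Rightarrow> real" where
  "H_norm r f = (let g = (SOME g. sob_chain r f g) in
     sqrt ((\<Sum>j\<le>nat \<lfloor>r\<rfloor>. (L2_norm (g j))^2) +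
           (if frac r = 0 then 0 else enn2real (gag_sq (frac r) (g (nat \<lfloor>r\<rfloor>))))))"

definition tint :: "ereal \<Rightarrow> real set" where
  "tint T = {t. 0 \<le> t \<and> ereal t < T}"

text \<open>The PDE at time t in weak (distributional) form on (0,1/2):
  m_t = -m_x u - 2 u_x m - kappa rho rho_x with m = -u_xx, paired with a test function,
  and rho_t = -(rho u)_x.  ut, rt are the time derivatives.\<close>
definition pde_at :: "real \<Rightarrow> (real \<Rightarrow> real) \<Rightarrow> (real \<Rightarrow> real) \<Rightarrow> (real \<Rightarrow> real) \<Rightarrow> (real \<Rightarrow> real) \<Rightarrow> bool" where
  "pde_at \<kappa> u \<rho> ut rt \<longleftrightarrow>
     (\<exists>ux uxx. L2_mem ux \<and> L2_mem uxx \<and> weak_deriv u ux \<and> weak_deriv ux uxx \<and>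
       (\<forall>\<phi>. test_fun \<phi> \<longrightarrow>
          - (LINT x:Ival|lborel. ut x * deriv (deriv \<phi>) x)
            = - (LINT x:Ival|lborel. u x * uxx x * deriv \<phi> x)
              + (LINT x:Ival|lborel. ux x * uxx x * \<phi> x)
              + \<kappa> / 2 * (LINT x:Ival|lborel. (\<rho> x)^2 * deriv \<phi> x)
          \<and> (LINT x:Ival|lborel. rt x * \<phi> x) = (LINT x:Ival|lborel. \<rho> x * u x * deriv \<phi> x)))"

text \<open>(u, rho) solves IBVP-2HS on [0,T) in the class
  C([0,T); H^s x H^(s-1)) \<inter> C^1([0,T); H^(s-1) x H^(s-2)).\<close>
definition is_sol :: "real \<Rightarrow> real \<Rightarrow> (real \<Rightarrow> real) \<Rightarrow> (real \<Rightarrow> real) \<Rightarrow> ereal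
    \<Rightarrow> (real \<Rightarrow> real \<Rightarrow> real) \<Rightarrow> (real \<Rightarrow> real \<Rightarrow> real) \<Rightarrow> bool" where
  "is_sol \<kappa> s u0 \<rho>0 T u \<rho> \<longleftrightarrow>
     0 < T \<and>
     (\<forall>x\<in>{0..1/2}. u 0 x = u0 x \<and> \<rho> 0 x = \<rho>0 x) \<and>
     (\<forall>t\<in>tint T. continuous_on {0..1/2} (u t) \<and> continuous_on {0..1/2} (\<rho> t) \<and>
        u t 0 = 0 \<and> u t (1/2) = 0 \<and> \<rho> t 0 = 0 \<and> \<rho> t (1/2) = 0 \<and>
        H_mem s (u t) \<and> H_mem (s - 1) (\<rho> t) \<and>
        ((\<lambda>\<tau>. H_norm s (\<lambda>x. u \<tau> x - u t x)) \<longlongrightarrow> 0) (at t within tint T) \<and>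
        ((\<lambda>\<tau>. H_norm (s - 1) (\<lambda>x. \<rho> \<tau> x - \<rho> t x)) \<longlongrightarrow> 0) (at t within tint T)) \<and>
     (\<exists>ut rt. \<forall>t\<in>tint T.
        H_mem (s - 1) (ut t) \<and> H_mem (s - 2) (rt t) \<and>
        ((\<lambda>\<tau>. H_norm (s - 1) (\<lambda>x. (u \<tau> x - u t x) / (\<tau> - t) - ut t x)) \<longlongrightarrow> 0) (at t within tint T) \<and>
        ((\<lambda>\<tau>. H_norm (s - 2) (\<lambda>x. (\<rho> \<tau> x - \<rho> t x) / (\<tau> - t) - rt t x)) \<longlongrightarrow> 0) (at t within tint T) \<and>
        ((\<lambda>\<tau>. H_norm (s - 1) (\<lambda>x. ut \<tau> x - ut t x)) \<longlongrightarrow> 0) (at t within tint T) \<and>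
        ((\<lambda>\<tau>. H_norm (s - 2) (\<lambda>x. rt \<tau> x - rt t x)) \<longlongrightarrow> 0) (at t within tint T) \<and>
        pde_at \<kappa> (u t) (\<rho> t) (ut t) (rt t))"

definition is_max_sol :: "real \<Rightarrow> real \<Rightarrow> (real \<Rightarrow> real) \<Rightarrow> (real \<Rightarrow> real) \<Rightarrow> ereal
    \<Rightarrow> (real \<Rightarrow> real \<Rightarrow> real) \<Rightarrow> (real \<Rightarrow> real \<Rightarrow> real) \<Rightarrow> bool" where
  "is_max_sol \<kappa> s u0 \<rho>0 T u \<rho> \<longleftrightarrow> is_sol \<kappa> s u0 \<rho>0 T u \<rho> \<and>
     \<not> (\<exists>T2 u2 \<rho>2. T < T2 \<and> is_sol \<kappa> s u0 \<rho>0 T2 u2 \<rho>2 \<and>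
          (\<forall>t\<in>tint T. \<forall>x\<in>{0..1/2}. u2 t x = u t x \<and> \<rho>2 t x = \<rho> t x))"

end

theory Submission
  imports Defs "HOL-Computational_Algebra.Polynomial"
begin

text \<open>
  The energy \<open>E = \<parallel>u\<^sub>x\<parallel>\<^sup>2 + \<kappa> \<parallel>\<rho>\<parallel>\<^sup>2\<close> in \<open>L\<^sub>2\<close> is conserved. Testing the momentum equation with \<open>u\<close> gives
  \<open>\<integral> u\<^sub>t\<^sub>x u\<^sub>x = \<kappa>/2 \<integral> \<rho>\<^sup>2 u\<^sub>x\<close>, and testing the continuity equation with \<open>\<rho>\<close> gives
  \<open>\<integral> \<rho>\<^sub>t \<rho> = -1/2 \<integral> \<rho>\<^sup>2 u\<^sub>x\<close>, so that the two contributions to the time derivative of \<open>E\<close> cancel. Since the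
  equations hold only in the sense of distributions, both tests are limits of test functions
  approximating \<open>u\<close> and \<open>\<rho>\<close>, which vanish at the end points, in \<open>H\<^sup>1\<close> and uniformly. Finally,
  \<open>u\<close> vanishes at 0, so \<open>\<bar>u\<bar> \<le> \<parallel>u\<^sub>x\<parallel>\<close>, and \<open>E\<close> controls the norm of \<open>(u, \<rho>)\<close> in \<open>H\<^sup>1 \<times> L\<^sub>2\<close>.
\<close>

section \<open>Inner product and norm on the interval\<close>

text \<open>Differentiating the energy in time requires \<open>ux\<close> and \<open>\<rho>\<close>
  to be differentiable in L2 as functions of t. The solution class provides this through norms of
  orders s - 1 \<ge> 1 and s - 2 \<ge> 0, but extracting it is the main obstacle:
  \<open>H_norm\<close> is evaluated on a chosen chain of weak derivatives and bounds an L2 norm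
  only for members of the space. The difference quotients therefore have to be shown to lie in the
  spaces of lower order. This is where s < 5/2 enters: the fractional part of s is below 1/2, and a
  function with a weak derivative in L2 agrees almost everywhere with a Hoelder continuous one of
  exponent 1/2, so its Gagliardo seminorm of every order below 1/2 is finite.

  One construction specific to dimension one, the primitive \<open>L2_prim\<close>, yields this
  Hoelder bound, the uniform bound of u by its derivative, and the approximation by test functions
  in H^1. Functions are not identified up to null sets, so equality in L2 appears throughout as an
  \<open>L2_norm\<close> of a difference being 0.\<close>

definition L2_ip :: "(real \<Rightarrow> real) \<Rightarrow> (real \<Rightarrow> real) \<Rightarrow> real" where
  "L2_ip f g = (LINT x:Ival|lborel. f x * g x)"

lemma Ival_sets [measurable, simp]: "Ival \<in> sets borel"
  by (simp add: Ival_def)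

lemma emeasure_Ival: "emeasure lborel Ival = ennreal (1/2)"
  by (simp add: Ival_def)

lemma measure_Ival: "measure lborel Ival = 1/2"
  by (simp add: Ival_def)

lemma integrable_indicator_Ival: "integrable lborel (indicator Ival :: real \<Rightarrow> real)"
  by (rule integrable_real_indicator) (simp_all only: emeasure_Ival ennreal_less_top infinity_ennreal_def sets_lborel Ival_sets)

lemma L2_mem_cong:
  assumes "\<And>x. x \<in> Ival \<Longrightarrow> f x = g x"
  shows "L2_mem f \<longleftrightarrow> L2_mem g"
proof -
  have "(\<lambda>x. indicator Ival x *\<^sub>R f x) = (\<lambda>x. indicator Ival x *\<^sub>R g x)"
    "(\<lambda>x. indicator Ival x *\<^sub>R (f x)^2) = (\<lambda>x. indicator Ival x *\<^sub>R (g x)^2)"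
    using assms by (auto simp: indicator_def fun_eq_iff)
  then show ?thesis
    by (simp add: L2_mem_def set_borel_measurable_def set_integrable_def)
qed

lemma L2_ip_cong:
  assumes "\<And>x. x \<in> Ival \<Longrightarrow> f x * g x = f' x * g' x"
  shows "L2_ip f g = L2_ip f' g'"
  unfolding L2_ip_def using assms by (intro set_lebesgue_integral_cong) auto

lemma L2_norm_cong:
  assumes "\<And>x. x \<in> Ival \<Longrightarrow> f x = g x"
  shows "L2_norm f = L2_norm g"
  unfolding L2_norm_def using assms
  by (intro arg_cong[where f=sqrt] set_lebesgue_integral_cong) auto

lemma L2_ip_commute: "L2_ip f g = L2_ip g f"
  by (simp add: L2_ip_def mult.commute)

lemma L2_ip_self_nonneg: "0 \<le> L2_ip f f"
  unfolding L2_ip_def set_lebesgue_integral_def by (intro Bochner_Integration.integral_nonneg) auto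

lemma L2_norm_sq: "(L2_norm f)^2 = L2_ip f f"
  using L2_ip_self_nonneg[of f] by (simp add: L2_norm_def L2_ip_def power2_eq_square)

lemma L2_norm_nonneg [simp]: "0 \<le> L2_norm f"
  using L2_ip_self_nonneg[of f] by (simp add: L2_norm_def L2_ip_def power2_eq_square)

lemma set_borel_measurable_times:
  fixes f g :: "real \<Rightarrow> real"
  assumes "set_borel_measurable lborel Ival f" "set_borel_measurable lborel Ival g"
  shows "set_borel_measurable lborel Ival (\<lambda>x. f x * g x)"
proof -
  have [measurable]: "(\<lambda>x. indicator Ival x *\<^sub>R f x) \<in> borel_measurable borel"
    "(\<lambda>x. indicator Ival x *\<^sub>R g x) \<in> borel_measurable borel"
    using assms by (auto simp: set_borel_measurable_def)
  have "(\<lambda>x. indicator Ival x *\<^sub>R (f x * g x)) =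
      (\<lambda>x. (indicator Ival x *\<^sub>R f x) * (indicator Ival x *\<^sub>R g x))"
    by (auto simp: indicator_def)
  then show ?thesis unfolding set_borel_measurable_def by (simp only: measurable_lborel1) measurable
qed

lemma L2_integrable_mult:
  assumes "L2_mem f" "L2_mem g"
  shows "set_integrable lborel Ival (\<lambda>x. f x * g x)"
proof -
  have int: "set_integrable lborel Ival (\<lambda>x. (f x)^2 + (g x)^2)"
    using assms by (auto simp: L2_mem_def)
  have "set_borel_measurable lborel Ival (\<lambda>x. f x * g x)"
    using assms by (auto simp: L2_mem_def intro: set_borel_measurable_times)
  moreover have "\<bar>a * b\<bar> \<le> a^2 + b^2" for a b :: real
    using sum_squares_bound[of "\<bar>a\<bar>" "\<bar>b\<bar>"] zero_le_power2[of a] zero_le_power2[of b]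
    by (simp only: abs_mult power2_abs)
  ultimately show ?thesis
    by (intro set_integrable_bound[OF int]) auto
qed

lemma L2_mem_add:
  assumes "L2_mem f" "L2_mem g"
  shows "L2_mem (\<lambda>x. f x + g x)"
proof -
  have [measurable]: "(\<lambda>x. indicator Ival x *\<^sub>R f x) \<in> borel_measurable borel"
    "(\<lambda>x. indicator Ival x *\<^sub>R g x) \<in> borel_measurable borel"
    using assms by (auto simp: set_borel_measurable_def L2_mem_def)
  have "(\<lambda>x. indicator Ival x *\<^sub>R (f x + g x)) =
      (\<lambda>x. (indicator Ival x *\<^sub>R f x) + (indicator Ival x *\<^sub>R g x))"
    by (auto simp: indicator_def)
  then have "set_borel_measurable lborel Ival (\<lambda>x. f x + g x)"
    unfolding set_borel_measurable_def by (simp only: measurable_lborel1) measurable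
  moreover have "set_integrable lborel Ival (\<lambda>x. (f x)^2 + (g x)^2 + 2 * (f x * g x))"
    using assms L2_integrable_mult[OF assms]
    by (intro set_integral_add set_integrable_mult_right) (auto simp: L2_mem_def)
  ultimately show ?thesis by (simp add: L2_mem_def power2_sum mult.assoc)
qed

lemma L2_mem_cmult:
  assumes "L2_mem f"
  shows "L2_mem (\<lambda>x. c * f x)"
proof -
  have [measurable]: "(\<lambda>x. indicator Ival x *\<^sub>R f x) \<in> borel_measurable borel"
    using assms by (auto simp: set_borel_measurable_def L2_mem_def)
  have "(\<lambda>x. indicator Ival x *\<^sub>R (c * f x)) = (\<lambda>x. c * (indicator Ival x *\<^sub>R f x))"
    by (auto simp: indicator_def)
  then have "set_borel_measurable lborel Ival (\<lambda>x. c * f x)"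
    unfolding set_borel_measurable_def by (simp only: measurable_lborel1) measurable
  then show ?thesis using assms by (simp add: L2_mem_def power_mult_distrib)
qed

lemma L2_mem_diff:
  assumes "L2_mem f" "L2_mem g"
  shows "L2_mem (\<lambda>x. f x - g x)"
  using L2_mem_add[OF assms(1) L2_mem_cmult[OF assms(2), of "-1"]] by simp

lemma L2_ip_add_left:
  "L2_mem f \<Longrightarrow> L2_mem g \<Longrightarrow> L2_mem h \<Longrightarrow>
    L2_ip (\<lambda>x. f x + g x) h = L2_ip f h + L2_ip g h"
  unfolding L2_ip_def by (simp add: distrib_right L2_integrable_mult)

lemma L2_ip_diff_left:
  "L2_mem f \<Longrightarrow> L2_mem g \<Longrightarrow> L2_mem h \<Longrightarrow>
    L2_ip (\<lambda>x. f x - g x) h = L2_ip f h - L2_ip g h"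
  unfolding L2_ip_def by (simp add: left_diff_distrib L2_integrable_mult)

lemma L2_ip_cmult_left: "L2_ip (\<lambda>x. c * f x) h = c * L2_ip f h"
  unfolding L2_ip_def by (simp add: mult.assoc)

lemma L2_ip_add_right:
  "L2_mem f \<Longrightarrow> L2_mem g \<Longrightarrow> L2_mem h \<Longrightarrow>
    L2_ip h (\<lambda>x. f x + g x) = L2_ip h f + L2_ip h g"
  by (simp add: L2_ip_commute[of h] L2_ip_add_left)

lemma L2_ip_diff_right:
  "L2_mem f \<Longrightarrow> L2_mem g \<Longrightarrow> L2_mem h \<Longrightarrow>
    L2_ip h (\<lambda>x. f x - g x) = L2_ip h f - L2_ip h g"
  by (simp add: L2_ip_commute[of h] L2_ip_diff_left)

lemma L2_ip_cmult_right: "L2_ip h (\<lambda>x. c * f x) = c * L2_ip h f"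
  by (simp add: L2_ip_commute[of h] L2_ip_cmult_left)

text \<open>The algebra behind Cauchy-Schwarz. The case \<open>d = 0\<close> does occur:
  \<open>L2_ip g g\<close> vanishes for every g that is zero almost everywhere on the
  interval.\<close>

lemma quadratic_nonneg_imp_discriminant:
  fixes a b d :: real
  assumes "\<And>c. 0 \<le> a - 2 * c * b + c^2 * d" "0 \<le> d"
  shows "b^2 \<le> a * d"
proof (cases "d = 0")
  case True
  have "b = 0"
  proof (rule ccontr)
    assume "b \<noteq> 0"
    \<comment> \<open>This value of \<open>c\<close> turns the quadratic expression into -1.\<close>
    with assms(1)[of "(a + 1) / (2 * b)"] True show False by simp
  qed
  with True show ?thesis by simp
next
  case False
  with assms have "d > 0" by simp
  \<comment> \<open>\<open>b / d\<close> minimises the quadratic in \<open>c\<close>.\<close>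
  with assms(1)[of "b / d"] show ?thesis
    by (simp add: field_simps power2_eq_square)
qed

lemma L2_Cauchy_Schwarz:
  assumes "L2_mem f" "L2_mem g"
  shows "\<bar>L2_ip f g\<bar> \<le> L2_norm f * L2_norm g"
proof -
  have "0 \<le> L2_ip f f - 2 * c * L2_ip f g + c^2 * L2_ip g g" for c
  proof -
    note m = assms L2_mem_cmult[OF assms(2), of c]
    have "0 \<le> L2_ip (\<lambda>x. f x - c * g x) (\<lambda>x. f x - c * g x)"
      by (rule L2_ip_self_nonneg)
    also have "\<dots> = L2_ip f f - 2 * c * L2_ip f g + c^2 * L2_ip g g"
      using m by (simp add: L2_ip_diff_left L2_ip_diff_right L2_mem_diff L2_ip_cmult_left
        L2_ip_cmult_right power2_eq_square L2_ip_commute[of g f] algebra_simps)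
    finally show ?thesis .
  qed
  from quadratic_nonneg_imp_discriminant[OF this L2_ip_self_nonneg]
  have "(L2_ip f g)^2 \<le> (L2_norm f * L2_norm g)^2"
    by (simp add: power_mult_distrib L2_norm_sq)
  then show ?thesis by (simp add: abs_le_square_iff[symmetric])
qed

lemma L2_norm_triangle:
  assumes "L2_mem f" "L2_mem g"
  shows "L2_norm (\<lambda>x. f x + g x) \<le> L2_norm f + L2_norm g"
proof (rule power2_le_imp_le)
  have "(L2_norm (\<lambda>x. f x + g x))^2 = L2_ip f f + 2 * L2_ip f g + L2_ip g g"
    using assms by (simp add: L2_norm_sq L2_ip_add_left L2_ip_add_right L2_mem_add
        L2_ip_commute[of g f])
  also have "\<dots> \<le> L2_ip f f + 2 * (L2_norm f * L2_norm g) + L2_ip g g"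
    using L2_Cauchy_Schwarz[OF assms] by simp
  also have "\<dots> = (L2_norm f + L2_norm g)^2"
    by (simp add: power2_sum L2_norm_sq)
  finally show "(L2_norm (\<lambda>x. f x + g x))^2 \<le> (L2_norm f + L2_norm g)^2" .
qed simp

lemma L2_norm_cmult: "L2_norm (\<lambda>x. c * f x) = \<bar>c\<bar> * L2_norm f"
proof (rule power2_eq_imp_eq)
  show "(L2_norm (\<lambda>x. c * f x))\<^sup>2 = (\<bar>c\<bar> * L2_norm f)\<^sup>2"
    unfolding power_mult_distrib L2_norm_sq L2_ip_cmult_left L2_ip_cmult_right
    by (simp add: power2_eq_square)
qed auto

lemma L2_norm_triangle_dist:
  assumes "L2_mem f" "L2_mem g" "L2_mem h"
  shows "L2_norm (\<lambda>x. f x - h x) \<le> L2_norm (\<lambda>x. f x - g x) + L2_norm (\<lambda>x. g x - h x)"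
  using L2_norm_triangle[OF L2_mem_diff[OF assms(1,2)] L2_mem_diff[OF assms(2,3)]] by simp

lemma L2_norm_minus_commute: "L2_norm (\<lambda>x. f x - g x) = L2_norm (\<lambda>x. g x - f x)"
  by (simp add: L2_norm_def power2_commute)

section \<open>Products with bounded and continuous functions\<close>

lemma L2_mem_bounded_mult:
  assumes "set_borel_measurable lborel Ival b" "\<And>x. x \<in> Ival \<Longrightarrow> \<bar>b x\<bar> \<le> B" "L2_mem f"
  shows "L2_mem (\<lambda>x. b x * f x)"
  unfolding L2_mem_def
proof
  show meas: "set_borel_measurable lborel Ival (\<lambda>x. b x * f x)"
    using assms by (auto simp: L2_mem_def intro: set_borel_measurable_times)
  have int: "set_integrable lborel Ival (\<lambda>x. B^2 * (f x)^2)"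
    using assms(3) by (auto simp: L2_mem_def)
  have "(b x * f x)^2 \<le> B^2 * (f x)^2" if "x \<in> Ival" for x
    using power_mono[OF assms(2)[OF that], of 2]
    by (auto simp: power_mult_distrib intro: mult_right_mono)
  then show "set_integrable lborel Ival (\<lambda>x. (b x * f x)^2)"
    using set_borel_measurable_times[OF meas meas]
    by (intro set_integrable_bound[OF int]) (auto simp: power2_eq_square)
qed

lemma L2_norm_bounded_mult:
  assumes "set_borel_measurable lborel Ival b" "\<And>x. x \<in> Ival \<Longrightarrow> \<bar>b x\<bar> \<le> B" "L2_mem f" "0 \<le> B"
  shows "L2_norm (\<lambda>x. b x * f x) \<le> B * L2_norm f"
proof (rule power2_le_imp_le)
  have "(L2_norm (\<lambda>x. b x * f x))^2 = (LINT x:Ival|lborel. (b x * f x)^2)"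
    unfolding L2_norm_sq L2_ip_def by (simp add: power2_eq_square)
  also have "\<dots> \<le> (LINT x:Ival|lborel. B^2 * (f x)^2)"
  proof (rule set_integral_mono)
    show "set_integrable lborel Ival (\<lambda>x. (b x * f x)^2)"
      using L2_mem_bounded_mult[OF assms(1-3)] by (simp add: L2_mem_def)
    show "set_integrable lborel Ival (\<lambda>x. B^2 * (f x)^2)"
      using assms(3) by (auto simp: L2_mem_def)
    show "(b x * f x)^2 \<le> B^2 * (f x)^2" if "x \<in> Ival" for x
      using power_mono[OF assms(2)[OF that], of 2]
      by (auto simp: power_mult_distrib intro: mult_right_mono)
  qed
  also have "\<dots> = (B * L2_norm f)^2"
    unfolding power_mult_distrib L2_norm_sq L2_ip_def by (simp add: power2_eq_square)
  finally show "(L2_norm (\<lambda>x. b x * f x))^2 \<le> (B * L2_norm f)^2" .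
qed (use assms in auto)

lemma L2_mem_const [simp]: "L2_mem (\<lambda>x. c)"
  unfolding L2_mem_def set_borel_measurable_def set_integrable_def
  by (auto simp: integrable_indicator_Ival)

text \<open>The exact value is sqrt (1/2). Rounding it up to 1 lets a uniform bound serve as an L2
  bound with no extra constant.\<close>

lemma L2_norm_one_le: "L2_norm (\<lambda>x. 1) \<le> 1"
  by (simp add: L2_norm_def set_lebesgue_integral_def measure_Ival)

lemma L2_mem_bounded:
  assumes "set_borel_measurable lborel Ival b" "\<And>x. x \<in> Ival \<Longrightarrow> \<bar>b x\<bar> \<le> B"
  shows "L2_mem b"
  using L2_mem_bounded_mult[OF assms, of "\<lambda>x. 1"] by simp

lemma L2_norm_bounded:
  assumes "set_borel_measurable lborel Ival b" "\<And>x. x \<in> Ival \<Longrightarrow> \<bar>b x\<bar> \<le> B" "0 \<le> B"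
  shows "L2_norm b \<le> B"
  using L2_norm_bounded_mult[OF assms(1,2), of "\<lambda>x. 1"] L2_norm_one_le assms(3)
    mult_left_mono[OF L2_norm_one_le assms(3)] by simp

lemma continuous_on_imp_set_borel_measurable_Ival:
  fixes f :: "real \<Rightarrow> real"
  assumes "continuous_on {0..1/2} f"
  shows "set_borel_measurable lborel Ival f"
proof -
  have "continuous_on Ival f"
    using assms by (rule continuous_on_subset) (auto simp: Ival_def)
  then show ?thesis
    using set_measurable_continuous_on[of "Ival" f] by (simp add: set_borel_measurable_def)
qed

lemma continuous_on_bounded_Ival:
  fixes f :: "real \<Rightarrow> real"
  assumes "continuous_on {0..1/2} f"
  obtains B where "0 \<le> B" "\<And>x. x \<in> {0..1/2} \<Longrightarrow> \<bar>f x\<bar> \<le> B"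
proof -
  have "bounded (f ` {0..1/2})"
    using assms by (intro compact_imp_bounded compact_continuous_image) auto
  then show ?thesis
    using that by (metis bounded_pos imageI less_imp_le real_norm_def)
qed

lemma Ival_closed: "x \<in> Ival \<Longrightarrow> x \<in> {0..1/2}"
  by (simp add: Ival_def)

lemma L2_mem_continuous:
  assumes "continuous_on {0..1/2} f"
  shows "L2_mem f"
proof -
  obtain B where "0 \<le> B" "\<And>x. x \<in> {0..1/2} \<Longrightarrow> \<bar>f x\<bar> \<le> B"
    using continuous_on_bounded_Ival[OF assms] by blast
  then show ?thesis
    using continuous_on_imp_set_borel_measurable_Ival[OF assms]
    by (intro L2_mem_bounded[of f B]) (blast dest: Ival_closed)+
qed

lemma L2_mem_continuous_mult:
  assumes "continuous_on {0..1/2} b" "L2_mem f"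
  shows "L2_mem (\<lambda>x. b x * f x)"
proof -
  obtain B where "0 \<le> B" "\<And>x. x \<in> {0..1/2} \<Longrightarrow> \<bar>b x\<bar> \<le> B"
    using continuous_on_bounded_Ival[OF assms(1)] by blast
  then show ?thesis
    using continuous_on_imp_set_borel_measurable_Ival[OF assms(1)] assms(2)
    by (intro L2_mem_bounded_mult[of b B f]) (blast dest: Ival_closed)+
qed

section \<open>Smooth functions and test functions\<close>

text \<open>Order \<open>k\<close> means differentiable \<open>k + 1\<close> times. Finite orders
  make induction possible: a rule such as the product rule reduces order \<open>k + 1\<close> of a
  function to order \<open>k\<close> of an expression for its derivative.\<close>

definition smooth_upto :: "nat \<Rightarrow> (real \<Rightarrow> real) \<Rightarrow> bool" where
  "smooth_upto k f \<longleftrightarrow> (\<forall>j\<le>k. \<forall>x. (deriv ^^ j) f differentiable (at x))"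

definition smooth_real :: "(real \<Rightarrow> real) \<Rightarrow> bool" where
  "smooth_real f \<longleftrightarrow> (\<forall>k. smooth_upto k f)"

lemma smooth_upto_0: "smooth_upto 0 f \<longleftrightarrow> (\<forall>x. f differentiable (at x))"
  by (simp add: smooth_upto_def)

lemma smooth_upto_Suc:
  "smooth_upto (Suc k) f \<longleftrightarrow> (\<forall>x. f differentiable (at x)) \<and> smooth_upto k (deriv f)"
proof -
  have "smooth_upto (Suc k) f \<longleftrightarrow>
      (\<forall>x. f differentiable (at x)) \<and> (\<forall>j\<le>k. \<forall>x. (deriv ^^ (Suc j)) f differentiable (at x))"
    unfolding smooth_upto_def
    by (metis (no_types, lifting) Suc_le_mono bot_nat_0.extremum funpow_0 not0_implies_Suc)
  then show ?thesis by (simp add: smooth_upto_def funpow_Suc_right del: funpow.simps)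
qed

lemma smooth_upto_mono: "smooth_upto k f \<Longrightarrow> j \<le> k \<Longrightarrow> smooth_upto j f"
  by (auto simp: smooth_upto_def)

lemma smooth_upto_DERIV:
  assumes "smooth_upto k f"
  shows "DERIV f x :> deriv f x"
  using smooth_upto_mono[OF assms, of 0]
  by (simp add: smooth_upto_0 DERIV_deriv_iff_real_differentiable)

lemma smooth_upto_SucI:
  assumes "\<And>x. DERIV f x :> f' x" "smooth_upto k f'"
  shows "smooth_upto (Suc k) f"
proof -
  have "deriv f = f'" using assms(1) by (auto simp: fun_eq_iff intro: DERIV_imp_deriv)
  then show ?thesis
    using assms real_differentiable_def by (auto simp: smooth_upto_Suc)
qed

lemma smooth_upto_const: "smooth_upto k (\<lambda>x. c)"
proof (induction k arbitrary: c)
  case 0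
  then show ?case by (simp add: smooth_upto_0)
next
  case (Suc k)
  then show ?case by (intro smooth_upto_SucI[where f' = "\<lambda>x. 0"]) auto
qed

lemma smooth_upto_add:
  "smooth_upto k f \<Longrightarrow> smooth_upto k g \<Longrightarrow> smooth_upto k (\<lambda>x. f x + g x)"
proof (induction k arbitrary: f g)
  case 0
  then show ?case by (simp add: smooth_upto_0)
next
  case (Suc k)
  have "smooth_upto k (\<lambda>x. deriv f x + deriv g x)"
    using Suc.prems by (intro Suc.IH) (auto simp: smooth_upto_Suc)
  then show ?case
    using Suc.prems[THEN smooth_upto_DERIV]
    by (intro smooth_upto_SucI[where f' = "\<lambda>x. deriv f x + deriv g x"] DERIV_add)
qed

lemma smooth_upto_mult:
  "smooth_upto k f \<Longrightarrow> smooth_upto k g \<Longrightarrow> smooth_upto k (\<lambda>x. f x * g x)"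
proof (induction k arbitrary: f g)
  case 0
  then show ?case by (simp add: smooth_upto_0)
next
  case (Suc k)
  have "smooth_upto k (\<lambda>x. deriv f x * g x + deriv g x * f x)"
    using Suc.prems
    by (intro smooth_upto_add Suc.IH) (auto simp: smooth_upto_Suc intro: smooth_upto_mono[of "Suc k"])
  moreover have "smooth_upto k f" "smooth_upto k g"
    using Suc.prems by (auto intro: smooth_upto_mono)
  ultimately show ?case
    using Suc.prems[THEN smooth_upto_DERIV]
    by (intro smooth_upto_SucI[where f' = "\<lambda>x. deriv f x * g x + deriv g x * f x"] DERIV_mult)
qed

lemma smooth_upto_affine:
  "smooth_upto k f \<Longrightarrow> smooth_upto k (\<lambda>x. f (a * x + b))"
proof (induction k arbitrary: f)
  case 0
  have "DERIV (\<lambda>x. f (a * x + b)) x :> deriv f (a * x + b) * a" for x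
    using smooth_upto_DERIV[OF 0]
    by (intro DERIV_chain2) (auto intro!: derivative_eq_intros)
  then show ?case by (auto simp: smooth_upto_0 real_differentiable_def)
next
  case (Suc k)
  have "DERIV (\<lambda>x. f (a * x + b)) x :> deriv f (a * x + b) * a" for x
    using smooth_upto_DERIV[OF Suc.prems]
    by (intro DERIV_chain2) (auto intro!: derivative_eq_intros)
  moreover have "smooth_upto k (\<lambda>x. deriv f (a * x + b) * a)"
    using Suc.prems by (intro smooth_upto_mult smooth_upto_const Suc.IH) (simp add: smooth_upto_Suc)
  ultimately show ?case by (rule smooth_upto_SucI)
qed

lemma smooth_real_const: "smooth_real (\<lambda>x. c)"
  by (simp add: smooth_real_def smooth_upto_const)

lemma smooth_real_add: "smooth_real f \<Longrightarrow> smooth_real g \<Longrightarrow> smooth_real (\<lambda>x. f x + g x)"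
  by (simp add: smooth_real_def smooth_upto_add)

lemma smooth_real_mult: "smooth_real f \<Longrightarrow> smooth_real g \<Longrightarrow> smooth_real (\<lambda>x. f x * g x)"
  by (simp add: smooth_real_def smooth_upto_mult)

lemma smooth_real_affine: "smooth_real f \<Longrightarrow> smooth_real (\<lambda>x. f (a * x + b))"
  by (simp add: smooth_real_def smooth_upto_affine)

lemma smooth_real_DERIV: "smooth_real f \<Longrightarrow> DERIV f x :> deriv f x"
  by (auto simp: smooth_real_def intro: smooth_upto_DERIV)

lemma smooth_real_deriv: "smooth_real f \<Longrightarrow> smooth_real (deriv f)"
  unfolding smooth_real_def using smooth_upto_Suc by blast

lemma smooth_real_antideriv:
  assumes "\<And>x. DERIV f x :> f' x" "smooth_real f'"
  shows "smooth_real f"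
  unfolding smooth_real_def
proof
  fix k
  have "smooth_upto (Suc k) f"
    using assms by (intro smooth_upto_SucI) (auto simp: smooth_real_def)
  then show "smooth_upto k f" by (rule smooth_upto_mono) simp
qed

lemma smooth_real_ident: "smooth_real (\<lambda>x. x)"
  by (rule smooth_real_antideriv[where f' = "\<lambda>x. 1"]) (auto intro: smooth_real_const)

lemma smooth_real_polynomial_function: "real_polynomial_function p \<Longrightarrow> smooth_real p"
proof (induction p rule: real_polynomial_function.induct)
  case (linear f)
  then obtain c where "f = (\<lambda>x. x * c)"
    using real_bounded_linear by blast
  then show ?case by (simp add: smooth_real_ident smooth_real_const smooth_real_mult)
qed (auto intro: smooth_real_const smooth_real_add smooth_real_mult)

lemma smooth_real_continuous_on: "smooth_real f \<Longrightarrow> continuous_on S f"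
  by (meson DERIV_continuous_on has_field_derivative_at_within smooth_real_DERIV)

text \<open>The family \<open>flat_exp p\<close> is closed under differentiation, which makes every member smooth.\<close>

definition flat_exp :: "real poly \<Rightarrow> real \<Rightarrow> real" where
  "flat_exp p x = (if x > 0 then poly p (1 / x) * exp (- 1 / x) else 0)"

lemma tendsto_poly_div_exp_0:
  fixes p :: "real poly"
  shows "((\<lambda>y. poly p y / exp y) \<longlongrightarrow> 0) at_top"
proof -
  have "((\<lambda>y. \<Sum>i\<le>degree p. coeff p i * (y ^ i / exp y)) \<longlongrightarrow> 0) at_top"
    by (intro tendsto_null_sum tendsto_mult_right_zero tendsto_power_div_exp_0)
  then show ?thesis
    by (simp add: poly_altdef sum_divide_distrib)
qed

text \<open>With y = 1/x the derivative of p(y) exp(-y) in x is y^2 (p(y) - p'(y)) exp(-y), and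
  \<open>[:0, 0, 1:]\<close> is the polynomial y^2.\<close>

lemma DERIV_flat_exp:
  "DERIV (flat_exp p) x :> flat_exp ([:0, 0, 1:] * (p - pderiv p)) x"
proof -
  consider "x > 0" | "x < 0" | "x = 0" by linarith
  then show ?thesis
  proof cases
    case 1
    have "DERIV (\<lambda>x. poly p (1 / x) * exp (- 1 / x)) x :>
        flat_exp ([:0, 0, 1:] * (p - pderiv p)) x"
      using 1 by (auto intro!: derivative_eq_intros DERIV_chain2[OF poly_DERIV]
          simp: flat_exp_def field_simps power2_eq_square)
    moreover have "\<forall>\<^sub>F y in nhds x. flat_exp p y = poly p (1 / y) * exp (- 1 / y)"
      using eventually_nhds_in_open[of "{0<..}" x] 1
      by (auto elim!: eventually_mono simp: flat_exp_def)
    ultimately show ?thesis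
      by (subst DERIV_cong_ev[OF refl _ refl])
  next
    case 2
    have "\<forall>\<^sub>F y in nhds x. flat_exp p y = 0"
      using eventually_nhds_in_open[of "{..<0}" x] 2
      by (auto elim!: eventually_mono simp: flat_exp_def)
    then show ?thesis
      using 2 by (subst DERIV_cong_ev[OF refl _ refl, where g = "\<lambda>_. 0"])
        (auto simp: flat_exp_def)
  next
    case 3
    \<comment> \<open>With y = 1/h the difference quotient at 0 is y p(y) exp(-y) for h > 0; the
      factor y = 1/h is the \<open>pCons 0\<close>.\<close>
    have "((\<lambda>y. poly (pCons 0 p) y / exp y) \<longlongrightarrow> 0) at_top"
      by (rule tendsto_poly_div_exp_0)
    then have "((\<lambda>h. poly (pCons 0 p) (inverse h) / exp (inverse h)) \<longlongrightarrow> 0) (at_right 0)"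
      by (rule filterlim_compose) (rule filterlim_inverse_at_top_right)
    then have "((\<lambda>h. flat_exp p h / h) \<longlongrightarrow> 0) (at_right 0)"
      by (rule Lim_transform_eventually)
        (auto simp: eventually_at_filter flat_exp_def field_simps exp_minus)
    moreover have "((\<lambda>h. flat_exp p h / h) \<longlongrightarrow> 0) (at_left 0)"
      by (rule Lim_transform_eventually[OF tendsto_const])
        (auto simp: eventually_at_filter flat_exp_def)
    ultimately have "((\<lambda>h. flat_exp p h / h) \<longlongrightarrow> 0) (at 0)"
      by (simp add: filterlim_split_at_real filterlim_split_at)
    with 3 show ?thesis
      by (simp add: DERIV_def flat_exp_def)
  qed
qed

lemma smooth_real_flat_exp: "smooth_real (flat_exp p)"
proof -
  have "smooth_upto k (flat_exp p)" for k
  proof (induction k arbitrary: p)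
    case 0
    then show ?case using DERIV_flat_exp by (auto simp: smooth_upto_0 real_differentiable_def)
  next
    case (Suc k)
    show ?case by (rule smooth_upto_SucI[OF DERIV_flat_exp Suc.IH])
  qed
  then show ?thesis by (simp add: smooth_real_def)
qed

section \<open>Test functions and their antiderivatives\<close>

lemma test_fun_altdef:
  "test_fun \<phi> \<longleftrightarrow> smooth_real \<phi> \<and>
    (\<exists>a b. 0 < a \<and> a \<le> b \<and> b < 1/2 \<and> (\<forall>x. x \<notin> {a..b} \<longrightarrow> \<phi> x = 0))"
  unfolding test_fun_def smooth_real_def smooth_upto_def by blast

lemma test_fun_smooth: "test_fun \<phi> \<Longrightarrow> smooth_real \<phi>"
  by (simp add: test_fun_altdef)

lemma test_fun_continuous_on: "test_fun \<phi> \<Longrightarrow> continuous_on S \<phi>"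
  by (simp add: test_fun_smooth smooth_real_continuous_on)

lemma test_fun_L2: "test_fun \<phi> \<Longrightarrow> L2_mem \<phi>"
  by (simp add: L2_mem_continuous test_fun_continuous_on)

lemma test_fun_mult_smooth: "test_fun \<phi> \<Longrightarrow> smooth_real f \<Longrightarrow> test_fun (\<lambda>x. \<phi> x * f x)"
  unfolding test_fun_altdef by (metis mult_zero_left smooth_real_mult)

lemma test_fun_cmult: "test_fun \<phi> \<Longrightarrow> test_fun (\<lambda>x. c * \<phi> x)"
  using test_fun_mult_smooth[OF _ smooth_real_const, of \<phi> c] by (simp add: mult.commute)

lemma test_fun_add:
  assumes "test_fun \<phi>" "test_fun \<psi>"
  shows "test_fun (\<lambda>x. \<phi> x + \<psi> x)"
proof -
  obtain a b where 1: "0 < a" "a \<le> b" "b < 1/2" "\<And>x. x \<notin> {a..b} \<Longrightarrow> \<phi> x = 0"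
    using assms(1) by (auto simp: test_fun_altdef)
  obtain c d where 2: "0 < c" "c \<le> d" "d < 1/2" "\<And>x. x \<notin> {c..d} \<Longrightarrow> \<psi> x = 0"
    using assms(2) by (auto simp: test_fun_altdef)
  have "\<phi> x + \<psi> x = 0" if "x \<notin> {min a c..max b d}" for x
    using that 1(4)[of x] 2(4)[of x] by (auto simp: min_def max_def split: if_splits)
  moreover have "0 < min a c" "min a c \<le> max b d" "max b d < 1/2" using 1 2 by auto
  ultimately show ?thesis
    using assms unfolding test_fun_altdef by (blast intro: smooth_real_add)
qed

lemma test_fun_diff: "test_fun \<phi> \<Longrightarrow> test_fun \<psi> \<Longrightarrow> test_fun (\<lambda>x. \<phi> x - \<psi> x)"
  using test_fun_add[OF _ test_fun_cmult[of \<psi> "-1"]] by simp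

lemma test_fun_DERIV: "test_fun \<phi> \<Longrightarrow> DERIV \<phi> x :> deriv \<phi> x"
  by (simp add: test_fun_smooth smooth_real_DERIV)

lemma test_fun_deriv:
  assumes "test_fun \<phi>"
  shows "test_fun (deriv \<phi>)"
proof -
  obtain a b where ab: "0 < a" "a \<le> b" "b < 1/2" "\<And>x. x \<notin> {a..b} \<Longrightarrow> \<phi> x = 0"
    using assms by (auto simp: test_fun_altdef)
  have "deriv \<phi> x = 0" if "x \<notin> {a..b}" for x
  proof -
    have "\<forall>\<^sub>F y in nhds x. \<phi> y = 0"
      using eventually_nhds_in_open[of "- {a..b}" x] that ab(4)
      by (simp add: open_Compl eventually_mono)
    then have "DERIV \<phi> x :> 0"
      by (subst DERIV_cong_ev[OF refl _ refl, where g = "\<lambda>_. 0"]) auto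
    then show ?thesis by (rule DERIV_imp_deriv)
  qed
  with ab show ?thesis
    using assms unfolding test_fun_altdef by (blast intro: smooth_real_deriv)
qed

text \<open>The integral of g from 0 to x. As an inner product with an indicator it inherits
  linearity in g, and Cauchy-Schwarz gives its continuity in x.\<close>

definition L2_prim :: "(real \<Rightarrow> real) \<Rightarrow> real \<Rightarrow> real" where
  "L2_prim g x = L2_ip (indicator {..<x}) g"

lemma L2_prim_continuous:
  assumes "\<And>x. DERIV F x :> f x" "continuous_on UNIV f" "0 \<le> x" "x \<le> 1/2"
  shows "L2_prim f x = F x - F 0"
proof -
  have "L2_prim f x = (LINT y:{0<..<x}|lborel. f y)"
    unfolding L2_prim_def L2_ip_def set_lebesgue_integral_def
    using assms(3,4) by (intro Bochner_Integration.integral_cong) (auto simp: indicator_def Ival_def)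
  also have "\<dots> = (LBINT y=ereal 0..ereal x. f y)"
    using assms(3) by (simp add: interval_lebesgue_integral_def einterval_eq)
  also have "\<dots> = F x - F 0"
    using assms by (intro interval_integral_FTC_finite)
      (auto intro: continuous_on_subset has_field_derivative_at_within
        simp: has_real_derivative_iff_has_vector_derivative[symmetric])
  finally show ?thesis .
qed

lemma L2_prim_half: "L2_prim g (1/2) = L2_ip (\<lambda>x. 1) g"
  unfolding L2_prim_def by (rule L2_ip_cong) (auto simp: Ival_def)

lemma continuous_antiderivative_UNIV:
  fixes f :: "real \<Rightarrow> real"
  assumes "continuous_on UNIV f"
  obtains F where "\<And>x. DERIV F x :> f x"
proof -
  have "\<exists>F. \<forall>x. -\<infinity> < ereal x \<longrightarrow> ereal x < \<infinity> \<longrightarrow> (F has_vector_derivative f x) (at x)"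
    using assms by (intro einterval_antiderivative) (auto simp: continuous_on_eq_continuous_at)
  then show ?thesis
    using that by (auto simp: has_real_derivative_iff_has_vector_derivative)
qed

text \<open>The vanishing integral is what keeps the support compact. The antiderivative is constant
  on each side of the support of \<open>\<psi>\<close>: on the left it equals its value at 0, which
  is normalised to 0, and on the right its value at 1/2, which is the integral of
  \<open>\<psi>\<close>.\<close>

lemma test_fun_antideriv:
  assumes "test_fun \<psi>" "L2_ip (\<lambda>x. 1) \<psi> = 0"
  obtains \<phi> where "test_fun \<phi>" "deriv \<phi> = \<psi>" "\<And>x. 0 \<le> x \<Longrightarrow> x \<le> 1/2 \<Longrightarrow> \<phi> x = L2_prim \<psi> x"
proof -
  obtain a b where ab: "0 < a" "a \<le> b" "b < 1/2" "\<And>x. x \<notin> {a..b} \<Longrightarrow> \<psi> x = 0"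
    using assms by (auto simp: test_fun_altdef)
  have cont: "continuous_on UNIV \<psi>"
    by (rule test_fun_continuous_on) fact
  obtain F where F: "\<And>x. DERIV F x :> \<psi> x"
    using continuous_antiderivative_UNIV[OF cont] by blast
  define \<phi> where "\<phi> x = F x - F 0" for x
  have D: "DERIV \<phi> x :> \<psi> x" for x
    unfolding \<phi>_def using F by (auto intro!: derivative_eq_intros)
  have prim: "\<phi> x = L2_prim \<psi> x" if "0 \<le> x" "x \<le> 1/2" for x
    using L2_prim_continuous[OF F cont that] by (simp add: \<phi>_def)
  have half: "\<phi> (1/2) = 0"
    using prim[of "1/2"] assms(2) L2_prim_half by simp
  have "\<phi> x = 0" if "x \<notin> {a..b}" for x
  proof (cases "x < a")
    case True
    have "\<exists>c. \<forall>y\<in>{..<a}. \<phi> y = c"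
    proof (rule has_field_derivative_zero_constant)
      show "(\<phi> has_field_derivative 0) (at y within {..<a})" if "y \<in> {..<a}" for y
        using D[of y] ab(4)[of y] that by (auto intro: has_field_derivative_at_within)
    qed auto
    then have "\<phi> x = \<phi> 0" using True ab(1) by auto
    then show ?thesis by (simp add: \<phi>_def)
  next
    case False
    have "\<exists>c. \<forall>y\<in>{b<..}. \<phi> y = c"
    proof (rule has_field_derivative_zero_constant)
      show "(\<phi> has_field_derivative 0) (at y within {b<..})" if "y \<in> {b<..}" for y
        using D[of y] ab(4)[of y] that by (auto intro: has_field_derivative_at_within)
    qed auto
    then have "\<phi> x = \<phi> (1/2)" using False that ab(3) by auto
    then show ?thesis by (simp add: half)
  qed
  then have "test_fun \<phi>"
    using ab smooth_real_antideriv[OF D test_fun_smooth[OF assms(1)]]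
    unfolding test_fun_altdef by blast
  moreover have "deriv \<phi> = \<psi>"
    using D by (auto simp: fun_eq_iff intro: DERIV_imp_deriv)
  ultimately show ?thesis using that prim by blast
qed

section \<open>Density of the test functions\<close>

lemma L2_norm_dominated_tendsto_0:
  assumes "\<And>n. L2_mem (d n)" "L2_mem h"
    and "AE x in lborel. x \<in> Ival \<longrightarrow> (\<lambda>n. d n x) \<longlonglongrightarrow> 0"
    and "\<And>n x. x \<in> Ival \<Longrightarrow> \<bar>d n x\<bar> \<le> h x"
  shows "(\<lambda>n. L2_norm (d n)) \<longlonglongrightarrow> 0"
proof -
  have "(\<lambda>n. LINT x|lborel. indicator Ival x *\<^sub>R (d n x)^2) \<longlonglongrightarrow> (LINT x|(lborel :: real measure). (0::real))"
  proof (rule integral_dominated_convergence[where w = "\<lambda>x. indicator Ival x *\<^sub>R (h x)^2"])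
    show "integrable lborel (\<lambda>x. indicator Ival x *\<^sub>R (h x)^2)"
      using assms(2) by (simp add: L2_mem_def set_integrable_def)
    show "(\<lambda>x. indicat_real Ival x *\<^sub>R (d n x)\<^sup>2) \<in> borel_measurable lborel" for n
      using assms(1)[of n] by (auto simp: L2_mem_def set_integrable_def)
    show "AE x in lborel. (\<lambda>n. indicat_real Ival x *\<^sub>R (d n x)\<^sup>2) \<longlonglongrightarrow> 0"
      using assms(3)
    proof eventually_elim
      case (elim x)
      then show ?case
        by (cases "x \<in> Ival") (auto intro!: tendsto_eq_intros)
    qed
    have "(d n x)^2 \<le> (h x)^2" if "x \<in> Ival" for n x
      using assms(4)[OF that, of n] by (metis abs_le_square_iff abs_ge_self order_trans)
    then show "AE x in lborel. norm (indicat_real Ival x *\<^sub>R (d n x)\<^sup>2)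
        \<le> indicat_real Ival x *\<^sub>R (h x)\<^sup>2" for n
      by (auto simp: indicator_def)
  qed auto
  then have "(\<lambda>n. sqrt (LINT x:Ival|lborel. (d n x)^2)) \<longlonglongrightarrow> sqrt 0"
    unfolding set_lebesgue_integral_def by (intro tendsto_real_sqrt) simp
  then show ?thesis by (simp add: L2_norm_def)
qed

text \<open>Instead of plateau functions, compactly supported bumps that converge pointwise to 1 on
  the open interval; dominated convergence needs no more.\<close>

definition cutoff :: "nat \<Rightarrow> real \<Rightarrow> real" where
  "cutoff n x = flat_exp 1 (real n * x + (- 1)) * flat_exp 1 (- real n * x + (real n / 2 - 1))"

lemma flat_exp_1_bounds: "0 \<le> flat_exp 1 x" "flat_exp 1 x \<le> 1"
  by (auto simp: flat_exp_def)

lemma cutoff_bounds: "0 \<le> cutoff n x" "cutoff n x \<le> 1"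
  unfolding cutoff_def by (auto intro!: mult_nonneg_nonneg mult_le_one flat_exp_1_bounds)

text \<open>The arguments of the two factors are n x - 1 and n (1/2 - x) - 1, both positive only for
  1/n < x < 1/2 - 1/n. The bound on \<open>n\<close> makes this interval nonempty.\<close>

lemma test_fun_cutoff:
  assumes "5 \<le> n"
  shows "test_fun (cutoff n)"
proof -
  have n: "real n \<ge> 5" using assms by simp
  have "cutoff n x = 0" if "x \<notin> {1 / n..1/2 - 1 / n}" for x
    using that n by (auto simp: cutoff_def flat_exp_def field_simps)
  moreover have "0 < 1 / real n" "1 / real n \<le> 1/2 - 1 / real n" "1/2 - 1 / real n < 1/2"
    using n by (auto simp: field_simps)
  moreover have "smooth_real (cutoff n)"
    unfolding cutoff_def by (intro smooth_real_mult smooth_real_affine smooth_real_flat_exp)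
  ultimately show ?thesis unfolding test_fun_altdef by blast
qed

text \<open>At a fixed interior point both arguments tend to infinity, and
  \<open>flat_exp 1 y\<close> = exp (-1/y) tends to 1 as y does so.\<close>

lemma cutoff_tendsto_1:
  assumes "x \<in> Ival"
  shows "(\<lambda>n. cutoff n x) \<longlonglongrightarrow> 1"
proof -
  have *: "(\<lambda>n. flat_exp 1 (c n)) \<longlonglongrightarrow> 1" if c: "filterlim c at_top sequentially" for c :: "nat \<Rightarrow> real"
  proof -
    have "(\<lambda>n. exp (- (1 / c n))) \<longlonglongrightarrow> exp (- 0)"
      using c by (intro tendsto_intros real_tendsto_divide_at_top[OF tendsto_const])
    moreover have "\<forall>\<^sub>F n in sequentially. c n > 0"
      using c by (simp add: filterlim_at_top_dense)
    ultimately show ?thesis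
      by (auto elim!: Lim_transform_eventually eventually_mono simp: flat_exp_def)
  qed
  have x: "x > 0" "1/2 - x > 0" using assms by (auto simp: Ival_def)
  have lin: "filterlim (\<lambda>n. real n * a + b) at_top sequentially" if "a > 0" for a b :: real
    using filterlim_tendsto_add_at_top[OF tendsto_const, of "\<lambda>n. real n * a" sequentially b]
      filterlim_at_top_mult_tendsto_pos[OF tendsto_const that filterlim_real_sequentially]
    by (simp add: add.commute)
  have "(\<lambda>n. flat_exp 1 (real n * x + - 1)) \<longlonglongrightarrow> 1"
    using lin[OF x(1)] by (rule *)
  moreover have "(\<lambda>n. flat_exp 1 (real n * (1/2 - x) + - 1)) \<longlonglongrightarrow> 1"
    using lin[OF x(2)] by (rule *)
  ultimately have "(\<lambda>n. flat_exp 1 (real n * x + - 1) * flat_exp 1 (real n * (1/2 - x) + - 1)) \<longlonglongrightarrow> 1 * 1"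
    by (rule tendsto_mult)
  then show ?thesis by (simp add: cutoff_def algebra_simps)
qed

text \<open>Weierstrass approximation takes the place of mollification: polynomials are smooth, so a
  cutoff times a polynomial is a test function. The cutoff may destroy uniform closeness near the
  end points but not closeness in L2, which is why \<open>f\<close> satisfies no boundary condition
  here.\<close>

lemma test_fun_dense_continuous:
  assumes "continuous_on {0..1/2} f" "0 < e"
  obtains \<psi> where "test_fun \<psi>" "L2_norm (\<lambda>x. f x - \<psi> x) < e"
proof -
  obtain p where p: "real_polynomial_function p" "\<And>x. x \<in> {0..1/2} \<Longrightarrow> \<bar>f x - p x\<bar> < e / 2"
    using Stone_Weierstrass_real_polynomial_function[of "{0..1/2}" f "e/2"] assms by auto
  have sp: "smooth_real p" using p(1) by (rule smooth_real_polynomial_function)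
  have cp: "continuous_on {0..1/2} p" using sp by (rule smooth_real_continuous_on)
  note L = L2_mem_continuous[OF assms(1)] L2_mem_continuous[OF cp]
  define c where "c n = cutoff (n + 5)" for n
  have tc: "test_fun (\<lambda>x. c n x * p x)" for n
    unfolding c_def by (intro test_fun_mult_smooth test_fun_cutoff sp) simp
  have "(\<lambda>n. L2_norm (\<lambda>x. p x - c n x * p x)) \<longlonglongrightarrow> 0"
  proof (rule L2_norm_dominated_tendsto_0)
    show "L2_mem (\<lambda>x. \<bar>p x\<bar>)"
      using cp by (intro L2_mem_continuous continuous_intros)
    show "L2_mem (\<lambda>x. p x - c n x * p x)" for n
      by (intro L2_mem_diff L test_fun_L2 tc)
    have "(\<lambda>n. p x - c n x * p x) \<longlonglongrightarrow> 0" if "x \<in> Ival" for x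
    proof -
      have "(\<lambda>n. c n x) \<longlonglongrightarrow> 1"
        unfolding c_def using cutoff_tendsto_1[OF that] by (rule LIMSEQ_ignore_initial_segment)
      then show ?thesis by (auto intro!: tendsto_eq_intros)
    qed
    then show "AE x in lborel. x \<in> Ival \<longrightarrow> (\<lambda>n. p x - c n x * p x) \<longlonglongrightarrow> 0" by simp
    show "\<bar>p x - c n x * p x\<bar> \<le> \<bar>p x\<bar>" for n x
    proof -
      have "\<bar>p x - c n x * p x\<bar> = \<bar>1 - c n x\<bar> * \<bar>p x\<bar>"
        by (simp add: abs_mult[symmetric] left_diff_distrib)
      also have "\<dots> \<le> 1 * \<bar>p x\<bar>"
        using cutoff_bounds[of "n + 5" x] by (intro mult_right_mono) (auto simp: c_def)
      finally show ?thesis by simp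
    qed
  qed
  then obtain n where n: "L2_norm (\<lambda>x. p x - c n x * p x) < e / 2"
    using assms(2) by (metis (no_types, lifting) eventually_sequentially half_gt_zero order_refl order_tendstoD(2))
  have "L2_norm (\<lambda>x. f x - c n x * p x) \<le> L2_norm (\<lambda>x. f x - p x) + L2_norm (\<lambda>x. p x - c n x * p x)"
    using L test_fun_L2[OF tc] by (intro L2_norm_triangle_dist)
  moreover have "L2_norm (\<lambda>x. f x - p x) \<le> e / 2"
  proof (rule L2_norm_bounded)
    show "set_borel_measurable lborel Ival (\<lambda>x. f x - p x)"
      using assms(1) cp by (intro continuous_on_imp_set_borel_measurable_Ival continuous_intros)
    show "\<bar>f x - p x\<bar> \<le> e / 2" if "x \<in> Ival" for x
      using p(2)[OF Ival_closed[OF that]] by simp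
  qed (use assms(2) in simp)
  ultimately show ?thesis using n that[OF tc[of n]] by simp
qed

definition clamp_sym :: "real \<Rightarrow> real \<Rightarrow> real" where
  "clamp_sym k y = max (- k) (min k y)"

text \<open>Measurability yields continuous functions that converge almost everywhere but without a
  dominating function. Truncating \<open>f\<close> and its approximants at the same height
  \<open>k\<close> supplies the dominating constant 2 k. The error splits into e/2 for truncating
  \<open>f\<close>, e/4 for the passage to a continuous function and e/4 for the passage to a test
  function.\<close>

lemma test_fun_dense:
  assumes "L2_mem f" "0 < e"
  obtains \<psi> where "test_fun \<psi>" "L2_norm (\<lambda>x. f x - \<psi> x) < e"
proof -
  have fm: "set_borel_measurable lborel Ival f" using assms by (simp add: L2_mem_def)
  have fm': "(\<lambda>x. indicator Ival x *\<^sub>R f x) \<in> borel_measurable borel"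
    using fm by (simp add: set_borel_measurable_def)
  have Lclamp: "L2_mem (\<lambda>x. clamp_sym k (f x))" if "k \<ge> 0" for k
  proof (rule L2_mem_bounded)
    have "(\<lambda>x. clamp_sym k (indicator Ival x *\<^sub>R f x)) \<in> borel_measurable borel"
      unfolding clamp_sym_def using fm' by measurable
    moreover have "(\<lambda>x. indicator Ival x *\<^sub>R clamp_sym k (f x)) = (\<lambda>x. clamp_sym k (indicator Ival x *\<^sub>R f x))"
      using that by (auto simp: indicator_def clamp_sym_def)
    ultimately show "set_borel_measurable lborel Ival (\<lambda>x. clamp_sym k (f x))"
      by (simp only: set_borel_measurable_def measurable_lborel2)
    show "\<bar>clamp_sym k (f x)\<bar> \<le> k" for x using that by (auto simp: clamp_sym_def)
  qed
  have "(\<lambda>n. L2_norm (\<lambda>x. f x - clamp_sym (real n) (f x))) \<longlonglongrightarrow> 0"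
  proof (rule L2_norm_dominated_tendsto_0)
    show "L2_mem (\<lambda>x. f x - clamp_sym (real n) (f x))" for n
      using assms Lclamp by (intro L2_mem_diff) auto
    show "L2_mem (\<lambda>x. \<bar>f x\<bar>)"
    proof -
      have "(\<lambda>x. \<bar>indicator Ival x *\<^sub>R f x\<bar>) \<in> borel_measurable borel"
        using fm' by measurable
      moreover have "(\<lambda>x. indicator Ival x *\<^sub>R \<bar>f x\<bar>) = (\<lambda>x. \<bar>indicator Ival x *\<^sub>R f x\<bar>)"
        by (auto simp: indicator_def)
      ultimately have "set_borel_measurable lborel Ival (\<lambda>x. \<bar>f x\<bar>)"
        by (simp only: set_borel_measurable_def measurable_lborel2)
      then show ?thesis using assms by (simp add: L2_mem_def)
    qed
    have "(\<lambda>n. f x - clamp_sym (real n) (f x)) \<longlonglongrightarrow> 0" for x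
    proof (rule tendsto_eventually)
      show "\<forall>\<^sub>F n in sequentially. f x - clamp_sym (real n) (f x) = 0"
        using eventually_ge_at_top[of "nat \<lceil>\<bar>f x\<bar>\<rceil>"]
        by eventually_elim (auto simp: clamp_sym_def max_def min_def abs_if nat_le_iff ceiling_le_iff split: if_splits)
    qed
    then show "AE x in lborel. x \<in> Ival \<longrightarrow> (\<lambda>n. f x - clamp_sym (real n) (f x)) \<longlonglongrightarrow> 0" by simp
    show "\<bar>f x - clamp_sym (real n) (f x)\<bar> \<le> \<bar>f x\<bar>" for n x
      by (auto simp: clamp_sym_def max_def min_def)
  qed
  then obtain k where k: "L2_norm (\<lambda>x. f x - clamp_sym (real k) (f x)) < e / 2"
    using assms(2) by (metis (no_types, lifting) eventually_sequentially half_gt_zero order_refl order_tendstoD(2))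
  have "(\<lambda>x. indicator Ival x *\<^sub>R f x) \<in> borel_measurable lebesgue"
    using fm' by (simp add: measurable_completion)
  then have "(\<lambda>x. indicator Ival x *\<^sub>R f x) measurable_on UNIV"
    by (intro lebesgue_measurable_imp_measurable_on_real) auto
  then obtain N g where N: "negligible N" and g: "\<And>n. continuous_on UNIV (g n)"
      and lim: "\<And>x. x \<notin> N \<Longrightarrow> (\<lambda>n. g n x) \<longlonglongrightarrow> indicator Ival x *\<^sub>R f x"
    unfolding measurable_on_def by auto
  have cg: "continuous_on {0..1/2} (\<lambda>x. clamp_sym (real k) (g n x))" for n
    unfolding clamp_sym_def by (intro continuous_intros continuous_on_subset[OF g]) auto
  have "(\<lambda>n. L2_norm (\<lambda>x. clamp_sym (real k) (f x) - clamp_sym (real k) (g n x))) \<longlonglongrightarrow> 0"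
  proof (rule L2_norm_dominated_tendsto_0)
    show "L2_mem (\<lambda>x. clamp_sym (real k) (f x) - clamp_sym (real k) (g n x))" for n
      using cg by (intro L2_mem_diff Lclamp L2_mem_continuous) auto
    show "L2_mem (\<lambda>x. 2 * real k)" by simp
    show "\<bar>clamp_sym (real k) (f x) - clamp_sym (real k) (g n x)\<bar> \<le> 2 * real k" for n x
      by (auto simp: clamp_sym_def max_def min_def)
    \<comment> \<open>A negligible set need not be Borel, so the statement is first made for the
      completed measure and then carried over to \<open>lborel\<close>.\<close>
    have "AE x in lebesgue. x \<notin> N"
      using N by (intro AE_not_in) (simp add: negligible_iff_null_sets)
    then have "AE x in lborel. x \<notin> N" by (simp add: AE_completion_iff)
    then show "AE x in lborel. x \<in> Ival \<longrightarrow>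
        (\<lambda>n. clamp_sym (real k) (f x) - clamp_sym (real k) (g n x)) \<longlonglongrightarrow> 0"
    proof eventually_elim
      case (elim x)
      have "(\<lambda>n. clamp_sym (real k) (f x) - clamp_sym (real k) (g n x))
          \<longlonglongrightarrow> clamp_sym (real k) (f x) - clamp_sym (real k) (f x)" if "x \<in> Ival"
        unfolding clamp_sym_def using lim[OF elim] that by (intro tendsto_intros) auto
      then show ?case by simp
    qed
  qed
  then obtain n where n: "L2_norm (\<lambda>x. clamp_sym (real k) (f x) - clamp_sym (real k) (g n x)) < e / 4"
    using assms(2) by (metis (no_types, lifting) eventually_sequentially zero_less_divide_iff zero_less_numeral order_refl order_tendstoD(2))
  obtain \<psi> where psi: "test_fun \<psi>" "L2_norm (\<lambda>x. clamp_sym (real k) (g n x) - \<psi> x) < e / 4"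
    using test_fun_dense_continuous[OF cg, of "e/4"] assms(2) by auto
  have "L2_norm (\<lambda>x. f x - \<psi> x) \<le> L2_norm (\<lambda>x. f x - clamp_sym (real k) (f x))
      + L2_norm (\<lambda>x. clamp_sym (real k) (f x) - \<psi> x)"
    using assms Lclamp test_fun_L2[OF psi(1)] by (intro L2_norm_triangle_dist) auto
  moreover have "L2_norm (\<lambda>x. clamp_sym (real k) (f x) - \<psi> x)
      \<le> L2_norm (\<lambda>x. clamp_sym (real k) (f x) - clamp_sym (real k) (g n x))
        + L2_norm (\<lambda>x. clamp_sym (real k) (g n x) - \<psi> x)"
    using Lclamp test_fun_L2[OF psi(1)] L2_mem_continuous[OF cg] by (intro L2_norm_triangle_dist) auto
  ultimately show ?thesis using that[OF psi(1)] k n psi(2) by simp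
qed

text \<open>A test function closer to \<open>h\<close> than the norm of \<open>h\<close> itself
  would give |h|^2 = <h, h - \<psi>> < |h|^2.\<close>

lemma L2_norm_zero_if_test_orthogonal:
  assumes "L2_mem h" "\<And>\<psi>. test_fun \<psi> \<Longrightarrow> L2_ip h \<psi> = 0"
  shows "L2_norm h = 0"
proof (rule ccontr)
  assume "L2_norm h \<noteq> 0"
  then have pos: "L2_norm h > 0" by (simp add: less_le)
  then obtain \<psi> where psi: "test_fun \<psi>" "L2_norm (\<lambda>x. h x - \<psi> x) < L2_norm h"
    using test_fun_dense[OF assms(1)] by blast
  note L = assms(1) test_fun_L2[OF psi(1)]
  have "(L2_norm h)^2 = L2_ip h (\<lambda>x. h x - \<psi> x)"
    using L assms(2)[OF psi(1)] by (simp add: L2_ip_diff_right L2_norm_sq)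
  also have "\<dots> \<le> L2_norm h * L2_norm (\<lambda>x. h x - \<psi> x)"
    using L2_Cauchy_Schwarz[OF assms(1) L2_mem_diff[OF L]] by simp
  also have "\<dots> < L2_norm h * L2_norm h"
    using pos psi(2) by simp
  finally show False by (simp add: power2_eq_square)
qed

section \<open>Weak derivatives\<close>

lemma weak_deriv_iff: "weak_deriv f g \<longleftrightarrow> (\<forall>\<phi>. test_fun \<phi> \<longrightarrow> L2_ip f (deriv \<phi>) = - L2_ip g \<phi>)"
  by (simp add: weak_deriv_def L2_ip_def)

lemma weak_deriv_cong:
  assumes "\<And>x. x \<in> Ival \<Longrightarrow> f x = f' x"
  shows "weak_deriv f g \<longleftrightarrow> weak_deriv f' g"
proof -
  have "L2_ip f h = L2_ip f' h" for h
    using assms by (intro L2_ip_cong) simp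
  then show ?thesis by (simp add: weak_deriv_iff)
qed

lemma weak_deriv_add:
  assumes "weak_deriv f f'" "weak_deriv g g'" "L2_mem f" "L2_mem g" "L2_mem f'" "L2_mem g'"
  shows "weak_deriv (\<lambda>x. f x + g x) (\<lambda>x. f' x + g' x)"
  using assms unfolding weak_deriv_iff
  by (simp add: L2_ip_add_left test_fun_L2 test_fun_deriv)

lemma weak_deriv_cmult:
  assumes "weak_deriv f f'"
  shows "weak_deriv (\<lambda>x. c * f x) (\<lambda>x. c * f' x)"
  using assms unfolding weak_deriv_iff by (simp add: L2_ip_cmult_left)

lemma weak_deriv_diff:
  assumes "weak_deriv f f'" "weak_deriv g g'" "L2_mem f" "L2_mem g" "L2_mem f'" "L2_mem g'"
  shows "weak_deriv (\<lambda>x. f x - g x) (\<lambda>x. f' x - g' x)"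
  using assms unfolding weak_deriv_iff
  by (simp add: L2_ip_diff_left test_fun_L2 test_fun_deriv)

text \<open>The difference of two weak derivatives is orthogonal to all test functions. This is what
  frees later norm estimates from the particular representative that a chain contains.\<close>

lemma weak_deriv_unique:
  assumes "weak_deriv f g" "weak_deriv f g'" "L2_mem g" "L2_mem g'"
  shows "L2_norm (\<lambda>x. g x - g' x) = 0"
proof (rule L2_norm_zero_if_test_orthogonal)
  show "L2_mem (\<lambda>x. g x - g' x)" by (intro L2_mem_diff assms)
  show "L2_ip (\<lambda>x. g x - g' x) \<psi> = 0" if "test_fun \<psi>" for \<psi>
    using assms that by (simp add: L2_ip_diff_left test_fun_L2 weak_deriv_iff)
qed

lemma L2_norm_eq_if_diff_zero:
  assumes "L2_mem g" "L2_mem g'" "L2_norm (\<lambda>x. g x - g' x) = 0"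
  shows "L2_norm g = L2_norm g'"
  using L2_norm_triangle_dist[OF assms(1,2) L2_mem_const[of 0]] assms(3)
    L2_norm_triangle_dist[OF assms(2,1) L2_mem_const[of 0]] L2_norm_minus_commute[of g' g]
  by simp

section \<open>Primitives of square integrable functions\<close>

lemma L2_mem_indicator_lessThan: "L2_mem (indicator {..<x})"
  by (rule L2_mem_bounded[where B = 1])
    (auto simp: set_borel_measurable_def indicator_def)

text \<open>Hoelder continuity of exponent 1/2: Cauchy-Schwarz against the signed indicator of the
  segment between x and y, whose squared norm is at most the length of the segment.\<close>

lemma L2_prim_diff_sq_le:
  assumes "L2_mem g"
  shows "(L2_prim g x - L2_prim g y)^2 \<le> \<bar>x - y\<bar> * (L2_norm g)^2"
proof -
  let ?d = "\<lambda>z. indicator {..<x} z - indicator {..<y} z :: real"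
  have Ld: "L2_mem ?d" by (intro L2_mem_diff L2_mem_indicator_lessThan)
  have "L2_prim g x - L2_prim g y = L2_ip ?d g"
    using assms L2_mem_indicator_lessThan by (simp add: L2_prim_def L2_ip_diff_left)
  then have "(L2_prim g x - L2_prim g y)^2 \<le> (L2_norm ?d * L2_norm g)^2"
    using L2_Cauchy_Schwarz[OF Ld assms] by (simp add: abs_le_square_iff[symmetric] abs_mult)
  also have "\<dots> = (L2_norm ?d)^2 * (L2_norm g)^2" by (rule power_mult_distrib)
  also have "(L2_norm ?d)^2 \<le> \<bar>x - y\<bar>"
  proof -
    have "(L2_norm ?d)^2 = (LINT z|lborel. indicator Ival z *\<^sub>R (?d z * ?d z))"
      by (simp add: L2_norm_sq L2_ip_def set_lebesgue_integral_def)
    also have "\<dots> \<le> (LINT z|lborel. indicator {min x y..max x y} z)"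
    proof (rule integral_mono)
      show "integrable lborel (\<lambda>z. indicator Ival z *\<^sub>R (?d z * ?d z))"
        using L2_integrable_mult[OF Ld Ld] by (simp add: set_integrable_def)
      show "integrable lborel (indicator {min x y..max x y} :: real \<Rightarrow> real)"
        by (rule integrable_real_indicator) (auto simp: emeasure_lborel_Icc_eq)
      show "indicator Ival z *\<^sub>R (?d z * ?d z) \<le> indicator {min x y..max x y} z" for z
        by (auto simp: indicator_def)
    qed
    also have "\<dots> = \<bar>x - y\<bar>" by (simp add: max_def min_def)
    finally show ?thesis .
  qed
  then have "(L2_norm ?d)^2 * (L2_norm g)^2 \<le> \<bar>x - y\<bar> * (L2_norm g)^2"
    by (rule mult_right_mono) simp
  finally show ?thesis .
qed

lemma L2_prim_0: "L2_prim g 0 = 0"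
proof -
  have "L2_prim g 0 = L2_ip (\<lambda>x. 0) g"
    unfolding L2_prim_def by (rule L2_ip_cong) (auto simp: Ival_def)
  then show ?thesis by (simp add: L2_ip_def)
qed

lemma L2_prim_abs_le:
  assumes "L2_mem g" "0 \<le> x" "x \<le> 1/2"
  shows "\<bar>L2_prim g x\<bar> \<le> L2_norm g"
proof -
  have "(L2_prim g x)^2 \<le> \<bar>x\<bar> * (L2_norm g)^2"
    using L2_prim_diff_sq_le[OF assms(1), of x 0] by (simp add: L2_prim_0)
  also have "\<dots> \<le> 1 * (L2_norm g)^2"
    using assms by (intro mult_right_mono) auto
  finally show ?thesis by (simp add: abs_le_square_iff[symmetric])
qed

lemma continuous_on_L2_prim:
  assumes "L2_mem g"
  shows "continuous_on S (L2_prim g)"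
proof -
  have "isCont (L2_prim g) y" for y
  proof -
    have "\<bar>L2_prim g x - L2_prim g y\<bar> \<le> sqrt \<bar>x - y\<bar> * L2_norm g" for x
      by (rule power2_le_imp_le) (use L2_prim_diff_sq_le[OF assms, of x y] in \<open>auto simp: power_mult_distrib\<close>)
    then have "\<forall>\<^sub>F x in at y. norm (L2_prim g x - L2_prim g y) \<le> sqrt \<bar>x - y\<bar> * L2_norm g"
      by (simp add: always_eventually)
    moreover have "((\<lambda>x. sqrt \<bar>x - y\<bar> * L2_norm g) \<longlongrightarrow> 0) (at y)"
      by (auto intro!: tendsto_eq_intros)
    ultimately have "((\<lambda>x. L2_prim g x - L2_prim g y) \<longlongrightarrow> 0) (at y)"
      by (rule Lim_null_comparison)
    then show ?thesis by (simp add: isCont_def LIM_zero_iff)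
  qed
  then show ?thesis by (simp add: continuous_at_imp_continuous_on)
qed

lemma L2_prim_diff:
  "L2_mem f \<Longrightarrow> L2_mem g \<Longrightarrow> L2_prim (\<lambda>x. f x - g x) x = L2_prim f x - L2_prim g x"
  by (simp add: L2_prim_def L2_ip_diff_right L2_mem_indicator_lessThan)

lemma L2_mem_prim: "L2_mem g \<Longrightarrow> L2_mem (L2_prim g)"
  by (rule L2_mem_continuous[OF continuous_on_L2_prim])

lemma test_fun_zero_ends: "test_fun \<phi> \<Longrightarrow> \<phi> 0 = 0" "test_fun \<phi> \<Longrightarrow> \<phi> (1/2) = 0"
  by (auto simp: test_fun_altdef)

lemma weak_deriv_L2_prim_test_fun:
  assumes "test_fun \<psi>"
  shows "weak_deriv (L2_prim \<psi>) \<psi>"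
  unfolding weak_deriv_iff
proof (intro allI impI)
  fix \<phi> assume phi: "test_fun \<phi>"
  have cont: "continuous_on UNIV \<psi>"
    by (rule test_fun_continuous_on) fact
  obtain F where F: "\<And>x. DERIV F x :> \<psi> x"
    using continuous_antiderivative_UNIV[OF cont] by blast
  have "isCont F x" for x
    using F by (rule DERIV_isCont)
  then have cF: "continuous_on UNIV F"
    by (simp add: continuous_at_imp_continuous_on)
  \<comment> \<open>\<open>G\<close> agrees with \<open>L2_prim \<psi>\<close> on the interval and
    is differentiable on the whole line by construction, as \<open>L2_prim_continuous\<close>
    demands of an antiderivative.\<close>
  define G where "G x = F x - F 0" for x
  have cG: "continuous_on UNIV G" unfolding G_def by (intro continuous_intros cF)
  have G: "L2_prim \<psi> x = G x" if "x \<in> Ival" for x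
    using L2_prim_continuous[OF F cont, of x] Ival_closed[OF that] by (simp add: G_def)
  have "DERIV (\<lambda>x. G x * \<phi> x) x :> G x * deriv \<phi> x + \<psi> x * \<phi> x" for x
    unfolding G_def using F test_fun_DERIV[OF phi]
    by (auto intro!: derivative_eq_intros)
  moreover have "continuous_on UNIV (\<lambda>x. G x * deriv \<phi> x + \<psi> x * \<phi> x)"
    using phi test_fun_deriv[OF phi] assms by (intro continuous_intros cG test_fun_continuous_on)
  ultimately have "L2_prim (\<lambda>x. G x * deriv \<phi> x + \<psi> x * \<phi> x) (1/2) = G (1/2) * \<phi> (1/2) - G 0 * \<phi> 0"
    by (rule L2_prim_continuous) auto
  then have "0 = L2_ip (\<lambda>x. 1) (\<lambda>x. G x * deriv \<phi> x + \<psi> x * \<phi> x)"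
    using test_fun_zero_ends[OF phi] by (simp add: L2_prim_half)
  also have "\<dots> = L2_ip G (deriv \<phi>) + L2_ip \<psi> \<phi>"
    using L2_integrable_mult[OF L2_mem_continuous[OF continuous_on_subset[OF cG]]
        test_fun_L2[OF test_fun_deriv[OF phi]]]
      L2_integrable_mult[OF test_fun_L2[OF assms] test_fun_L2[OF phi]]
    by (simp add: L2_ip_def)
  also have "L2_ip G (deriv \<phi>) = L2_ip (L2_prim \<psi>) (deriv \<phi>)"
    using G by (intro L2_ip_cong) simp
  finally show "L2_ip (L2_prim \<psi>) (deriv \<phi>) = - L2_ip \<psi> \<phi>" by simp
qed

text \<open>The bound is demanded only for \<open>e \<le> 1\<close>, so that estimates which absorb
  a small error into a constant can be used. The case e = 1 gives \<bar>r\<bar> \<le> K, which makes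
  \<bar>r\<bar> / (2 K) an admissible choice.\<close>

lemma abs_le_all_multiples_imp_zero:
  fixes r K :: real
  assumes "\<And>e. 0 < e \<Longrightarrow> e \<le> 1 \<Longrightarrow> \<bar>r\<bar> \<le> e * K"
  shows "r = 0"
proof (rule ccontr)
  assume "r \<noteq> 0"
  then have r: "\<bar>r\<bar> > 0" by simp
  with assms[of 1] have K: "K > 0" "\<bar>r\<bar> \<le> K" by simp_all
  with r assms[of "\<bar>r\<bar> / (2 * K)"] show False by (simp add: field_simps)
qed

text \<open>Both sides of the defining identity depend continuously on \<open>g\<close> in L2 for
  fixed \<open>\<phi>\<close>, so the case of a test function extends by density.\<close>

lemma weak_deriv_L2_prim:
  assumes "L2_mem g"
  shows "weak_deriv (L2_prim g) g"
  unfolding weak_deriv_iff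
proof (intro allI impI)
  fix \<phi> assume phi: "test_fun \<phi>"
  note L = assms test_fun_L2[OF phi] test_fun_L2[OF test_fun_deriv[OF phi]]
  let ?r = "L2_ip (L2_prim g) (deriv \<phi>) + L2_ip g \<phi>"
  let ?K = "L2_norm (deriv \<phi>) + L2_norm \<phi>"
  have bound: "\<bar>?r\<bar> \<le> e * ?K" if e: "e > 0" for e
  proof -
    obtain \<psi> where psi: "test_fun \<psi>" "L2_norm (\<lambda>x. g x - \<psi> x) < e"
      using test_fun_dense[OF assms e] by blast
    note Lp = test_fun_L2[OF psi(1)]
    let ?h = "\<lambda>x. g x - \<psi> x"
    have Lh: "L2_mem ?h" by (intro L2_mem_diff assms Lp)
    have "L2_prim ?h = (\<lambda>x. L2_prim g x - L2_prim \<psi> x)"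
      using assms Lp by (auto simp: L2_prim_diff)
    then have "?r = L2_ip (L2_prim ?h) (deriv \<phi>) + L2_ip ?h \<phi>"
      using weak_deriv_L2_prim_test_fun[OF psi(1)] phi L Lp
      by (simp add: L2_ip_diff_left L2_mem_prim weak_deriv_iff)
    then have "\<bar>?r\<bar> \<le> \<bar>L2_ip (L2_prim ?h) (deriv \<phi>)\<bar> + \<bar>L2_ip ?h \<phi>\<bar>" by simp
    also have "\<dots> \<le> L2_norm (L2_prim ?h) * L2_norm (deriv \<phi>) + L2_norm ?h * L2_norm \<phi>"
      by (intro add_mono L2_Cauchy_Schwarz L2_mem_prim Lh L)
    also have "\<dots> \<le> e * L2_norm (deriv \<phi>) + e * L2_norm \<phi>"
    proof -
      have "L2_norm (L2_prim ?h) \<le> L2_norm ?h"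
        using L2_prim_abs_le[OF Lh]
        by (intro L2_norm_bounded continuous_on_imp_set_borel_measurable_Ival continuous_on_L2_prim Lh)
          (auto dest: Ival_closed)
      then show ?thesis using psi(2) by (intro add_mono mult_right_mono) auto
    qed
    finally show ?thesis by (simp add: distrib_left)
  qed
  from bound have "?r = 0" by (rule abs_le_all_multiples_imp_zero)
  then show "L2_ip (L2_prim g) (deriv \<phi>) = - L2_ip g \<phi>" by simp
qed

text \<open>A test function within 1/4 of the constant 1 in L2 has integral within 1/4 of 1/2, hence
  a nonzero one, and can be rescaled.\<close>

lemma test_fun_unit_mass:
  obtains \<eta> where "test_fun \<eta>" "L2_ip (\<lambda>x. 1) \<eta> = 1"
proof -
  obtain \<psi> where psi: "test_fun \<psi>" "L2_norm (\<lambda>x. 1 - \<psi> x) < 1/4"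
    using test_fun_dense[OF L2_mem_const[of 1], of "1/4"] by auto
  note Lp = test_fun_L2[OF psi(1)]
  have "L2_norm (\<lambda>x. 1) * L2_norm (\<lambda>x. 1 - \<psi> x) \<le> 1 * L2_norm (\<lambda>x. 1 - \<psi> x)"
    by (intro mult_right_mono L2_norm_one_le) simp
  then have "\<bar>L2_ip (\<lambda>x. 1) (\<lambda>x. 1 - \<psi> x)\<bar> < 1/4"
    using L2_Cauchy_Schwarz[OF L2_mem_const[of 1] L2_mem_diff[OF L2_mem_const[of 1] Lp]] psi(2) by simp
  moreover have "L2_ip (\<lambda>x. 1) (\<lambda>x. 1 - \<psi> x) = L2_ip (\<lambda>x. 1) (\<lambda>x. 1) - L2_ip (\<lambda>x. 1) \<psi>"
    using Lp by (simp add: L2_ip_diff_right)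
  moreover have "L2_ip (\<lambda>x. 1) (\<lambda>x. 1) = 1/2"
    by (simp add: L2_ip_def set_lebesgue_integral_def measure_Ival)
  ultimately have c: "L2_ip (\<lambda>x. 1) \<psi> \<noteq> 0" by auto
  show ?thesis
    by (rule that[of "\<lambda>x. (1 / L2_ip (\<lambda>x. 1) \<psi>) * \<psi> x"])
      (use c in \<open>simp_all only: test_fun_cmult[OF psi(1)] L2_ip_cmult_right, simp\<close>)
qed

text \<open>The du Bois-Reymond lemma. Subtracting a multiple of a fixed \<open>\<eta>\<close> of
  integral 1 from \<open>\<psi>\<close> leaves a function of integral 0, which is the derivative of
  a test function and so is orthogonal to \<open>w\<close>. The constant is therefore <w,
  \<eta>>.\<close>

lemma weak_deriv_zero_imp_const:
  assumes "weak_deriv w (\<lambda>x. 0)" "L2_mem w"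
  obtains k where "L2_norm (\<lambda>x. w x - k) = 0"
proof -
  obtain \<eta> where eta: "test_fun \<eta>" "L2_ip (\<lambda>x. 1) \<eta> = 1" by (rule test_fun_unit_mass)
  define k where "k = L2_ip w \<eta>"
  have "L2_norm (\<lambda>x. w x - k) = 0"
  proof (rule L2_norm_zero_if_test_orthogonal)
    show "L2_mem (\<lambda>x. w x - k)" by (intro L2_mem_diff assms L2_mem_const)
    fix \<psi> assume psi: "test_fun \<psi>"
    define c where "c = L2_ip (\<lambda>x. 1) \<psi>"
    note L = assms(2) test_fun_L2[OF psi] test_fun_L2[OF eta(1)]
    have t: "test_fun (\<lambda>x. \<psi> x - c * \<eta> x)" by (intro test_fun_diff test_fun_cmult psi eta)
    have "L2_ip (\<lambda>x. 1) (\<lambda>x. \<psi> x - c * \<eta> x) = 0"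
      using L eta(2) by (simp add: L2_ip_diff_right L2_mem_cmult L2_ip_cmult_right c_def)
    then obtain \<phi> where phi: "test_fun \<phi>" "deriv \<phi> = (\<lambda>x. \<psi> x - c * \<eta> x)"
      by (rule test_fun_antideriv[OF t])
    have "L2_ip w (deriv \<phi>) = - L2_ip (\<lambda>x. 0) \<phi>"
      using assms(1) phi(1) unfolding weak_deriv_iff by blast
    then have "L2_ip w (\<lambda>x. \<psi> x - c * \<eta> x) = 0"
      by (simp add: phi(2) L2_ip_def)
    then have "L2_ip w \<psi> = c * k"
      using L by (simp add: L2_ip_diff_right L2_mem_cmult L2_ip_cmult_right k_def)
    moreover have "L2_ip (\<lambda>x. k) \<psi> = k * c"
      using L2_ip_cmult_left[of k "\<lambda>x. 1" \<psi>] by (simp add: c_def)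
    ultimately show "L2_ip (\<lambda>x. w x - k) \<psi> = 0"
      using L by (simp add: L2_ip_diff_left)
  qed
  then show ?thesis by (rule that)
qed

lemma weak_deriv_imp_L2_prim:
  assumes "weak_deriv f g" "L2_mem f" "L2_mem g"
  obtains k where "L2_norm (\<lambda>x. f x - (k + L2_prim g x)) = 0"
proof -
  have "weak_deriv (\<lambda>x. f x - L2_prim g x) (\<lambda>x. g x - g x)"
    by (intro weak_deriv_diff weak_deriv_L2_prim L2_mem_prim assms)
  then obtain k where "L2_norm (\<lambda>x. f x - L2_prim g x - k) = 0"
    using weak_deriv_zero_imp_const[of "\<lambda>x. f x - L2_prim g x"] L2_mem_diff[OF assms(2) L2_mem_prim[OF assms(3)]]
    by auto
  then show ?thesis by (intro that[of k]) (simp add: algebra_simps)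
qed

lemma L2_norm_zero_continuous:
  assumes "continuous_on {0..1/2} w" "L2_norm w = 0" "x \<in> {0..1/2}"
  shows "w x = 0"
proof -
  have cont: "continuous_on {0..1/2} (\<lambda>x. (w x)^2)" by (intro continuous_intros assms)
  have "set_integrable lborel Ival (\<lambda>x. (w x)^2)"
    using L2_mem_continuous[OF assms(1)] by (simp add: L2_mem_def)
  from set_borel_integral_eq_integral(2)[OF this]
  have "integral {0<..<1/2} (\<lambda>x. (w x)^2) = 0"
    using assms(2) L2_norm_sq[of w] by (simp add: L2_ip_def Ival_def power2_eq_square)
  then have "integral {0..1/2} (\<lambda>x. (w x)^2) = 0"
    by (simp add: integral_open_interval_real)
  then show ?thesis
    using integral_eq_0_iff[OF cont] assms(3) by auto
qed

text \<open>Continuity on the closed interval turns equality in L2 into equality at every point, end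
  points included; evaluation at 0 then identifies the constant.\<close>

lemma weak_deriv_FTC:
  assumes "weak_deriv f g" "continuous_on {0..1/2} f" "L2_mem g" "x \<in> {0..1/2}"
  shows "f x = f 0 + L2_prim g x"
proof -
  obtain k where k: "L2_norm (\<lambda>x. f x - (k + L2_prim g x)) = 0"
    using weak_deriv_imp_L2_prim[OF assms(1) L2_mem_continuous[OF assms(2)] assms(3)] by blast
  have c: "continuous_on {0..1/2} (\<lambda>x. f x - (k + L2_prim g x))"
    by (intro continuous_intros assms continuous_on_L2_prim)
  show ?thesis
    using L2_norm_zero_continuous[OF c k assms(4)] L2_norm_zero_continuous[OF c k, of 0]
    by (simp add: L2_prim_0)
qed

text \<open>Approximation happens at the level of the derivative. Since \<open>v\<close> vanishes at
  both ends, \<open>g\<close> has integral 0; the integral \<open>c\<close> of an approximant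
  \<open>\<psi>\<close> is therefore no larger than the L2 error, and removing it by means of
  \<open>\<eta>\<close> makes the approximant the derivative of a test function. Uniform closeness
  follows because a primitive is bounded by the norm of its derivative.\<close>

lemma test_fun_dense_H10:
  assumes "weak_deriv v g" "continuous_on {0..1/2} v" "L2_mem g" "v 0 = 0" "v (1/2) = 0" "0 < e"
  obtains \<phi> where "test_fun \<phi>" "L2_norm (\<lambda>x. g x - deriv \<phi> x) < e"
    "\<And>x. x \<in> {0..1/2} \<Longrightarrow> \<bar>v x - \<phi> x\<bar> \<le> e"
proof -
  note FTC = weak_deriv_FTC[OF assms(1,2,3)]
  have g0: "L2_ip (\<lambda>x. 1) g = 0"
    using FTC[of "1/2"] assms(4,5) by (simp add: L2_prim_half)
  obtain \<eta> where eta: "test_fun \<eta>" "L2_ip (\<lambda>x. 1) \<eta> = 1" by (rule test_fun_unit_mass)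
  \<comment> \<open>Removing the integral of \<open>\<psi>\<close> can add up to
    \<open>L2_norm \<eta>\<close> times the original error, hence this divisor.\<close>
  define d where "d = e / (1 + L2_norm \<eta>)"
  have pos: "1 + L2_norm \<eta> > 0" by (simp add: add_pos_nonneg)
  have "d > 0" using assms(6) pos by (simp add: d_def)
  then obtain \<psi> where psi: "test_fun \<psi>" "L2_norm (\<lambda>x. g x - \<psi> x) < d"
    using test_fun_dense[OF assms(3)] by blast
  note L = assms(3) test_fun_L2[OF psi(1)] test_fun_L2[OF eta(1)]
  define c where "c = L2_ip (\<lambda>x. 1) \<psi>"
  have c: "\<bar>c\<bar> \<le> L2_norm (\<lambda>x. g x - \<psi> x)"
  proof -
    have "c = - L2_ip (\<lambda>x. 1) (\<lambda>x. g x - \<psi> x)"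
      using L g0 by (simp add: c_def L2_ip_diff_right)
    then have "\<bar>c\<bar> \<le> L2_norm (\<lambda>x. 1) * L2_norm (\<lambda>x. g x - \<psi> x)"
      using L2_Cauchy_Schwarz[OF L2_mem_const[of 1] L2_mem_diff[OF L(1,2)]] by simp
    also have "\<dots> \<le> 1 * L2_norm (\<lambda>x. g x - \<psi> x)"
      by (intro mult_right_mono L2_norm_one_le) simp
    finally show ?thesis by simp
  qed
  have t: "test_fun (\<lambda>x. \<psi> x - c * \<eta> x)" by (intro test_fun_diff test_fun_cmult psi eta)
  have "L2_ip (\<lambda>x. 1) (\<lambda>x. \<psi> x - c * \<eta> x) = 0"
    using L eta(2) by (simp add: L2_ip_diff_right L2_mem_cmult L2_ip_cmult_right c_def)
  then obtain \<phi> where phi: "test_fun \<phi>" "deriv \<phi> = (\<lambda>x. \<psi> x - c * \<eta> x)"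
      "\<And>x. 0 \<le> x \<Longrightarrow> x \<le> 1/2 \<Longrightarrow> \<phi> x = L2_prim (\<lambda>x. \<psi> x - c * \<eta> x) x"
    using test_fun_antideriv[OF t] by blast
  have Lh: "L2_mem (\<lambda>x. g x - deriv \<phi> x)"
    by (intro L2_mem_diff assms(3) test_fun_L2 test_fun_deriv phi)
  have close: "L2_norm (\<lambda>x. g x - deriv \<phi> x) < e"
  proof -
    have "L2_norm (\<lambda>x. g x - deriv \<phi> x) = L2_norm (\<lambda>x. (g x - \<psi> x) + c * \<eta> x)"
      by (simp add: phi(2) algebra_simps)
    also have "\<dots> \<le> L2_norm (\<lambda>x. g x - \<psi> x) + L2_norm (\<lambda>x. c * \<eta> x)"
      by (intro L2_norm_triangle L2_mem_diff L2_mem_cmult L)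
    also have "L2_norm (\<lambda>x. c * \<eta> x) \<le> L2_norm (\<lambda>x. g x - \<psi> x) * L2_norm \<eta>"
      unfolding L2_norm_cmult by (intro mult_right_mono c) simp
    finally have "L2_norm (\<lambda>x. g x - deriv \<phi> x) \<le> L2_norm (\<lambda>x. g x - \<psi> x) * (1 + L2_norm \<eta>)"
      by (simp add: distrib_left)
    also have "\<dots> < d * (1 + L2_norm \<eta>)"
      using psi(2) pos by (intro mult_strict_right_mono)
    also have "\<dots> = e" using pos by (simp add: d_def)
    finally show ?thesis .
  qed
  show ?thesis
  proof (rule that[OF phi(1) close])
    fix x :: real assume x: "x \<in> {0..1/2}"
    have "v x - \<phi> x = L2_prim (\<lambda>x. g x - deriv \<phi> x) x"
      using FTC[OF x] assms(4) phi(3)[of x] x L2_prim_diff[OF assms(3) test_fun_L2[OF test_fun_deriv[OF phi(1)]]]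
      by (simp add: phi(2))
    then show "\<bar>v x - \<phi> x\<bar> \<le> e"
      using L2_prim_abs_le[OF Lh, of x] x close by simp
  qed
qed

section \<open>Fractional Sobolev membership\<close>

lemma AE_zero_if_L2_norm_zero:
  assumes "L2_mem d" "L2_norm d = 0"
  shows "AE x in lborel. x \<in> Ival \<longrightarrow> d x = 0"
proof -
  have "integrable lborel (\<lambda>x. indicator Ival x *\<^sub>R (d x)^2)"
    using assms(1) by (simp add: L2_mem_def set_integrable_def)
  moreover have "(LINT x|lborel. indicator Ival x *\<^sub>R (d x)^2) = 0"
    using assms(2) L2_norm_sq[of d]
    by (simp add: L2_ip_def set_lebesgue_integral_def power2_eq_square)
  ultimately have "AE x in lborel. indicator Ival x *\<^sub>R (d x)^2 = 0"
    by (subst (asm) integral_nonneg_eq_0_iff_AE) auto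
  then show ?thesis by eventually_elim (auto simp: indicator_def)
qed

section \<open>Finiteness of the Gagliardo seminorm\<close>

definition gag_integrand :: "real \<Rightarrow> (real \<Rightarrow> real) \<Rightarrow> real \<times> real \<Rightarrow> ennreal" where
  "gag_integrand \<sigma> f p = indicator (Ival \<times> Ival) p *
      ennreal (\<bar>f (fst p) - f (snd p)\<bar>^2 / \<bar>fst p - snd p\<bar> powr (1 + 2*\<sigma>))"

lemma gag_sq_alt: "gag_sq \<sigma> f = (\<integral>\<^sup>+ p. gag_integrand \<sigma> f p \<partial>(lborel \<Otimes>\<^sub>M lborel))"
  by (simp add: gag_sq_def gag_integrand_def)

lemma gag_integrand_measurable:
  assumes "set_borel_measurable lborel Ival f"
  shows "gag_integrand \<sigma> f \<in> borel_measurable (lborel \<Otimes>\<^sub>M lborel)"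
proof -
  \<comment> \<open>Only the restriction of \<open>f\<close> to the interval is measurable; its
    extension by zero is measurable everywhere and gives the same integrand.\<close>
  define F where "F x = indicator Ival x *\<^sub>R f x" for x
  have [measurable]: "F \<in> borel_measurable borel"
    using assms by (simp add: F_def[abs_def] set_borel_measurable_def)
  have "gag_integrand \<sigma> f = (\<lambda>p. indicator Ival (fst p) * indicator Ival (snd p) *
      ennreal (\<bar>F (fst p) - F (snd p)\<bar>^2 / \<bar>fst p - snd p\<bar> powr (1 + 2*\<sigma>)))"
    by (auto simp: gag_integrand_def F_def indicator_def fun_eq_iff)
  then show ?thesis by simp
qed

lemma gag_integrand_lincomb_le:
  "gag_integrand \<sigma> (\<lambda>x. a * f x + b * g x) p
    \<le> ennreal (2 * a^2) * gag_integrand \<sigma> f p + ennreal (2 * b^2) * gag_integrand \<sigma> g p"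
proof (cases "p \<in> Ival \<times> Ival")
  case True
  define w where "w = \<bar>fst p - snd p\<bar> powr (1 + 2*\<sigma>)"
  define c where "c = f (fst p) - f (snd p)"
  define d where "d = g (fst p) - g (snd p)"
  have w: "w \<ge> 0" by (simp add: w_def)
  have "(a * c + b * d)^2 \<le> 2 * (a * c)^2 + 2 * (b * d)^2"
    using sum_squares_bound[of "a * c" "b * d"] by (simp add: power2_sum)
  then have "(a * c + b * d)^2 / w \<le> (2 * (a * c)^2 + 2 * (b * d)^2) / w"
    using w by (rule divide_right_mono)
  then have "ennreal ((a * c + b * d)^2 / w) \<le> ennreal (2 * a^2 * (c^2 / w) + 2 * b^2 * (d^2 / w))"
    by (intro ennreal_leI) (simp add: power_mult_distrib add_divide_distrib)
  also have "\<dots> = ennreal (2 * a^2) * ennreal (c^2 / w) + ennreal (2 * b^2) * ennreal (d^2 / w)"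
    using w by (simp only: ennreal_plus[symmetric] ennreal_mult[symmetric] mult_nonneg_nonneg
        divide_nonneg_nonneg zero_le_power2 zero_le_numeral)
  finally show ?thesis
    using True by (simp add: gag_integrand_def c_def d_def w_def algebra_simps)
qed (simp add: gag_integrand_def)

lemma gag_sq_lincomb_finite:
  assumes "set_borel_measurable lborel Ival f" "set_borel_measurable lborel Ival g"
    and "gag_sq \<sigma> f < \<infinity>" "gag_sq \<sigma> g < \<infinity>"
  shows "gag_sq \<sigma> (\<lambda>x. a * f x + b * g x) < \<infinity>"
proof -
  note [measurable] = assms(1,2)[THEN gag_integrand_measurable, of \<sigma>]
  have "gag_sq \<sigma> (\<lambda>x. a * f x + b * g x) \<le> (\<integral>\<^sup>+ p. ennreal (2 * a^2) * gag_integrand \<sigma> f p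
      + ennreal (2 * b^2) * gag_integrand \<sigma> g p \<partial>(lborel \<Otimes>\<^sub>M lborel))"
    unfolding gag_sq_alt by (intro nn_integral_mono gag_integrand_lincomb_le)
  also have "\<dots> = ennreal (2 * a^2) * gag_sq \<sigma> f + ennreal (2 * b^2) * gag_sq \<sigma> g"
    unfolding gag_sq_alt by (subst nn_integral_add) (auto simp: nn_integral_cmult)
  also have "\<dots> < \<infinity>"
    using assms(3,4) by (simp add: ennreal_mult_less_top)
  finally show ?thesis .
qed

text \<open>The interval contains all differences x - y of points of \<open>Ival\<close>. The
  negative half is reflected to the positive one, and the reflection is spelled
  \<open>0 + - 1 * z\<close> to fit the affine substitution rule.\<close>

lemma nn_integral_abs_powr_finite:
  fixes a :: real
  assumes "a > -1"
  shows "(\<integral>\<^sup>+ z. indicator {-1/2..1/2} z * ennreal (\<bar>z\<bar> powr a) \<partial>lborel) < \<infinity>"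
proof -
  let ?h = "\<lambda>z::real. indicator {0..1/2} z * ennreal (\<bar>z\<bar> powr a)"
  have "(\<lambda>x. \<bar>x\<bar> powr a) integrable_on {0..1/2}"
    using integrable_on_powr_from_0[OF assms, of "1/2"]
    by (rule integrable_eq) auto
  then obtain I where "((\<lambda>x. \<bar>x\<bar> powr a) has_integral I) {0..1/2}" by blast
  from nn_integral_has_integral_lebesgue'[OF _ this]
  have I: "(\<integral>\<^sup>+ z. ?h z \<partial>lborel) = ennreal I" by (simp add: mult.commute)
  have "(\<integral>\<^sup>+ z. indicator {-1/2..1/2} z * ennreal (\<bar>z\<bar> powr a) \<partial>lborel)
      \<le> (\<integral>\<^sup>+ z. ?h z + ?h (0 + - 1 * z) \<partial>lborel)"
    by (intro nn_integral_mono) (auto simp: indicator_def)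
  also have "\<dots> = (\<integral>\<^sup>+ z. ?h z \<partial>lborel) + (\<integral>\<^sup>+ z. ?h (0 + - 1 * z) \<partial>lborel)"
    by (intro nn_integral_add) auto
  also have "(\<integral>\<^sup>+ z. ?h (0 + - 1 * z) \<partial>lborel) = (\<integral>\<^sup>+ z. ?h z \<partial>lborel)"
    by (subst (2) nn_integral_real_affine[where c = "-1" and t = 0]) auto
  finally show ?thesis by (rule le_less_trans) (simp add: I)
qed

text \<open>The Hoelder bound of exponent 1/2 reduces the integrand to a constant times \<bar>x -
  y\<bar> to the power -2 \<sigma>, which is integrable near the diagonal exactly because \<sigma> <
  1/2.\<close>

lemma gag_sq_finite_if_weak_deriv:
  assumes "weak_deriv f g" "L2_mem f" "L2_mem g" "\<sigma> < 1/2"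
  shows "gag_sq \<sigma> f < \<infinity>"
proof -
  obtain k where k: "L2_norm (\<lambda>x. f x - (k + L2_prim g x)) = 0"
    using weak_deriv_imp_L2_prim[OF assms(1-3)] by blast
  have "AE x in lborel. x \<in> Ival \<longrightarrow> f x - (k + L2_prim g x) = 0"
    by (rule AE_zero_if_L2_norm_zero[OF _ k]) (intro L2_mem_diff L2_mem_add L2_mem_const L2_mem_prim assms)
  then have ae: "AE x in lborel. x \<in> Ival \<longrightarrow> f x = k + L2_prim g x"
    by eventually_elim auto
  define c where "c = (L2_norm g)^2"
  define I where "I = (\<integral>\<^sup>+ z. indicator {-1/2..1/2} z * ennreal (\<bar>z\<bar> powr (- 2 * \<sigma>)) \<partial>lborel)"
  have I: "I < \<infinity>" unfolding I_def using assms(4) by (intro nn_integral_abs_powr_finite) auto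
  \<comment> \<open>The bound is available only where \<open>f\<close> equals its continuous
    representative. That holds for almost every value of each variable, which suffices for the
    iterated integral.\<close>
  have pt: "gag_integrand \<sigma> f (x, y) \<le> indicator Ival x * (ennreal c * (indicator {-1/2..1/2} (x + - 1 * y)
      * ennreal (\<bar>x + - 1 * y\<bar> powr (- 2 * \<sigma>))))"
    if "x \<in> Ival \<longrightarrow> f x = k + L2_prim g x" "y \<in> Ival \<longrightarrow> f y = k + L2_prim g y" for x y
  proof (cases "x \<in> Ival \<and> y \<in> Ival")
    case True
    have "(f x - f y)^2 \<le> \<bar>x - y\<bar> * c"
      using L2_prim_diff_sq_le[OF assms(3), of x y] that True by (simp add: c_def)
    then have "(f x - f y)^2 / \<bar>x - y\<bar> powr (1 + 2 * \<sigma>) \<le> \<bar>x - y\<bar> * c / \<bar>x - y\<bar> powr (1 + 2 * \<sigma>)"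
      by (rule divide_right_mono) simp
    \<comment> \<open>On the diagonal both sides are 0, by \<open>0 powr a = 0\<close>.\<close>
    also have "\<dots> = c * \<bar>x - y\<bar> powr (- 2 * \<sigma>)"
      by (cases "x = y") (auto simp: powr_add powr_minus field_simps)
    finally have "ennreal ((f x - f y)^2 / \<bar>x - y\<bar> powr (1 + 2 * \<sigma>))
        \<le> ennreal c * ennreal (\<bar>x - y\<bar> powr (- 2 * \<sigma>))"
      by (simp add: ennreal_mult[symmetric] c_def ennreal_leI)
    moreover have "x - y \<in> {-1/2..1/2}" using True by (auto simp: Ival_def)
    ultimately show ?thesis using True by (simp add: gag_integrand_def)
  qed (auto simp: gag_integrand_def)
  have "gag_sq \<sigma> f = (\<integral>\<^sup>+ x. \<integral>\<^sup>+ y. gag_integrand \<sigma> f (x, y) \<partial>lborel \<partial>lborel)"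
    unfolding gag_sq_alt using assms(2)
    by (intro lborel.nn_integral_fst[symmetric] gag_integrand_measurable) (simp add: L2_mem_def)
  also have "\<dots> \<le> (\<integral>\<^sup>+ x. indicator Ival x * (ennreal c * I) \<partial>lborel)"
    using ae
  proof (intro nn_integral_mono_AE, eventually_elim)
    case (elim x)
    have "(\<integral>\<^sup>+ y. gag_integrand \<sigma> f (x, y) \<partial>lborel) \<le>
        (\<integral>\<^sup>+ y. indicator Ival x * (ennreal c * (indicator {-1/2..1/2} (x + - 1 * y)
          * ennreal (\<bar>x + - 1 * y\<bar> powr (- 2 * \<sigma>)))) \<partial>lborel)"
      by (intro nn_integral_mono_AE eventually_mono[OF ae]) (rule pt[OF elim(2)])
    also have "\<dots> = indicator Ival x * (ennreal c * (\<integral>\<^sup>+ y. indicator {-1/2..1/2} (x + - 1 * y)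
          * ennreal (\<bar>x + - 1 * y\<bar> powr (- 2 * \<sigma>)) \<partial>lborel))"
      by (simp add: nn_integral_cmult)
    also have "(\<integral>\<^sup>+ y. indicator {-1/2..1/2} (x + - 1 * y)
          * ennreal (\<bar>x + - 1 * y\<bar> powr (- 2 * \<sigma>)) \<partial>lborel) = I"
      unfolding I_def by (subst (2) nn_integral_real_affine[where c = "-1" and t = x]) auto
    finally show ?case .
  qed
  also have "\<dots> = (ennreal c * I) * ennreal (1/2)"
    by (simp add: nn_integral_multc emeasure_Ival mult.commute del: ennreal_half)
  also have "\<dots> < \<infinity>" using I by (simp add: ennreal_mult_less_top del: ennreal_half)
  finally show ?thesis .
qed

section \<open>Chains of weak derivatives and the Sobolev norm\<close>

lemma sob_chainD:
  assumes "sob_chain r f g"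
  shows "\<And>x. x \<in> Ival \<Longrightarrow> g 0 x = f x" "\<And>j. j \<le> nat \<lfloor>r\<rfloor> \<Longrightarrow> L2_mem (g j)"
    "\<And>j. j < nat \<lfloor>r\<rfloor> \<Longrightarrow> weak_deriv (g j) (g (Suc j))"
    "frac r \<noteq> 0 \<Longrightarrow> gag_sq (frac r) (g (nat \<lfloor>r\<rfloor>)) < \<infinity>"
  using assms by (auto simp: sob_chain_def)

lemma H_mem_lincomb:
  assumes "H_mem r f" "H_mem r g"
  shows "H_mem r (\<lambda>x. a * f x + b * g x)"
proof -
  obtain F where F: "sob_chain r f F" using assms by (auto simp: H_mem_def)
  obtain G where G: "sob_chain r g G" using assms by (auto simp: H_mem_def)
  note F' = sob_chainD[OF F] and G' = sob_chainD[OF G]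
  have "sob_chain r (\<lambda>x. a * f x + b * g x) (\<lambda>j x. a * F j x + b * G j x)"
    unfolding sob_chain_def
  proof (intro conjI ballI allI impI)
    show "weak_deriv (\<lambda>x. a * F j x + b * G j x) (\<lambda>x. a * F (Suc j) x + b * G (Suc j) x)"
      if "j < nat \<lfloor>r\<rfloor>" for j
      using that by (intro weak_deriv_add weak_deriv_cmult L2_mem_cmult F' G') auto
    show "gag_sq (frac r) (\<lambda>x. a * F (nat \<lfloor>r\<rfloor>) x + b * G (nat \<lfloor>r\<rfloor>) x) < \<infinity>" if "frac r \<noteq> 0"
      using F'(2)[of "nat \<lfloor>r\<rfloor>"] G'(2)[of "nat \<lfloor>r\<rfloor>"] F'(4) G'(4) that
      by (intro gag_sq_lincomb_finite) (auto simp: L2_mem_def)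
  qed (auto intro!: L2_mem_add L2_mem_cmult F' G' simp: F'(1) G'(1))
  then show ?thesis using assms by (auto simp: H_mem_def)
qed

text \<open>\<open>H_norm\<close> chooses a chain with \<open>SOME\<close>, so it controls nothing unless membership in the space
  is known. The solution class only gives membership one order higher than the norm in which
  the time derivative is taken.\<close>

lemma H_mem_pred:
  assumes "H_mem r f" "1 \<le> r" "frac r < 1/2"
  shows "H_mem (r - 1) f"
proof -
  obtain g where g: "sob_chain r f g" using assms by (auto simp: H_mem_def)
  note g' = sob_chainD[OF g]
  define n where "n = nat \<lfloor>r - 1\<rfloor>"
  have n: "nat \<lfloor>r\<rfloor> = Suc n" using assms(2) by (simp add: n_def) linarith
  have fr: "frac (r - 1) = frac r" by (simp add: frac_def)
  \<comment> \<open>The shortened chain ends in \<open>g n\<close>, whose weak derivative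
    \<open>g (Suc n)\<close> is still present in the longer chain; this gives the fractional
    condition at the new top order.\<close>
  have "gag_sq (frac r) (g n) < \<infinity>"
    using g'(2)[of n] g'(2)[of "Suc n"] g'(3)[of n] n assms(3)
    by (intro gag_sq_finite_if_weak_deriv[of _ "g (Suc n)"]) auto
  then have "sob_chain (r - 1) f g"
    using g' n unfolding sob_chain_def fr n_def[symmetric] by auto
  then show ?thesis using assms(2) by (auto simp: H_mem_def)
qed

lemma L2_norm_chain_le_H_norm:
  assumes "H_mem r f"
  obtains g where "sob_chain r f g" "\<And>j. j \<le> nat \<lfloor>r\<rfloor> \<Longrightarrow> L2_norm (g j) \<le> H_norm r f"
proof -
  define g where "g = (SOME g. sob_chain r f g)"
  have g: "sob_chain r f g"
    using assms someI_ex[of "sob_chain r f"] unfolding g_def H_mem_def by blast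
  have "L2_norm (g j) \<le> H_norm r f" if "j \<le> nat \<lfloor>r\<rfloor>" for j
  proof -
    have "(L2_norm (g j))^2 \<le> (\<Sum>j\<le>nat \<lfloor>r\<rfloor>. (L2_norm (g j))^2)"
      using that by (intro member_le_sum) auto
    also have "\<dots> \<le> (\<Sum>j\<le>nat \<lfloor>r\<rfloor>. (L2_norm (g j))^2) +
        (if frac r = 0 then 0 else enn2real (gag_sq (frac r) (g (nat \<lfloor>r\<rfloor>))))"
      by simp
    finally show ?thesis
      unfolding H_norm_def Let_def g_def[symmetric] by (rule real_le_rsqrt)
  qed
  with g show ?thesis by (rule that)
qed

lemma L2_mem_H_mem:
  assumes "H_mem r f"
  shows "L2_mem f"
proof -
  obtain g where "sob_chain r f g" using assms by (auto simp: H_mem_def)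
  then show ?thesis using sob_chainD(1,2)[of r f g] L2_mem_cong[of "g 0" f] by auto
qed

lemma sob_chain_weak_deriv:
  assumes "sob_chain r f g" "1 \<le> r"
  shows "L2_mem (g 1)" "weak_deriv f (g 1)" "1 \<le> nat \<lfloor>r\<rfloor>"
proof -
  show r: "1 \<le> nat \<lfloor>r\<rfloor>" using assms(2) by linarith
  then show "L2_mem (g 1)" using sob_chainD(2)[OF assms(1)] by blast
  have "weak_deriv (g 0) (g (Suc 0))"
    using sob_chainD(3)[OF assms(1), of 0] r by linarith
  then show "weak_deriv f (g 1)"
    using weak_deriv_cong[of "g 0" f "g 1"] sob_chainD(1)[OF assms(1)] by simp
qed

lemma H_mem_weak_deriv:
  assumes "H_mem r f" "1 \<le> r"
  obtains g where "L2_mem g" "weak_deriv f g"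
proof -
  obtain g where g: "sob_chain r f g" using assms by (auto simp: H_mem_def)
  show ?thesis using sob_chain_weak_deriv[OF g assms(2)] that by blast
qed

lemma L2_norm_le_H_norm:
  assumes "H_mem r f"
  shows "L2_norm f \<le> H_norm r f"
proof -
  obtain g where g: "sob_chain r f g" "\<And>j. j \<le> nat \<lfloor>r\<rfloor> \<Longrightarrow> L2_norm (g j) \<le> H_norm r f"
    using L2_norm_chain_le_H_norm[OF assms] by blast
  then show ?thesis using g(2)[of 0] L2_norm_cong[of "g 0" f] sob_chainD(1)[OF g(1)] by auto
qed

text \<open>The chain chosen inside \<open>H_norm\<close> need not contain \<open>h\<close>, but by
  uniqueness its first derivative has the same L2 norm.\<close>

lemma L2_norm_weak_deriv_le_H_norm:
  assumes "H_mem r f" "1 \<le> r" "weak_deriv f h" "L2_mem h"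
  shows "L2_norm h \<le> H_norm r f"
proof -
  obtain g where g: "sob_chain r f g" "\<And>j. j \<le> nat \<lfloor>r\<rfloor> \<Longrightarrow> L2_norm (g j) \<le> H_norm r f"
    using L2_norm_chain_le_H_norm[OF assms(1)] by blast
  note g1 = sob_chain_weak_deriv[OF g(1) assms(2)]
  have "L2_norm h = L2_norm (g 1)"
    by (rule L2_norm_eq_if_diff_zero[OF assms(4) g1(1) weak_deriv_unique[OF assms(3) g1(2) assms(4) g1(1)]])
  then show ?thesis using g(2) g1(3) by simp
qed

lemma H_norm_1_le:
  assumes "L2_mem f" "weak_deriv f h" "L2_mem h"
  shows "H_norm 1 f \<le> L2_norm f + L2_norm h"
proof -
  define g where "g = (SOME g. sob_chain 1 f g)"
  \<comment> \<open>An explicit chain guarantees that the choice inside \<open>H_norm\<close>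
    returns a genuine one. Since \<open>frac 1 = 0\<close>, no seminorm term arises.\<close>
  have "sob_chain 1 f (\<lambda>j. if j = 0 then f else h)"
    using assms by (auto simp: sob_chain_def)
  then have g: "sob_chain 1 f g" using someI[of "sob_chain 1 f"] unfolding g_def by blast
  note g1 = sob_chain_weak_deriv[OF g order_refl]
  have 1: "L2_norm (g 1) = L2_norm h"
    by (rule L2_norm_eq_if_diff_zero[OF g1(1) assms(3) weak_deriv_unique[OF g1(2) assms(2) g1(1) assms(3)]])
  have 0: "L2_norm (g 0) = L2_norm f" using sob_chainD(1)[OF g] by (rule L2_norm_cong)
  have "H_norm 1 f = sqrt ((L2_norm f)^2 + (L2_norm h)^2)"
    unfolding H_norm_def Let_def g_def[symmetric] using 0 1 by (simp add: atMost_Suc)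
  also have "\<dots> \<le> L2_norm f + L2_norm h" by (rule sqrt_sum_squares_le_sum) auto
  finally show ?thesis .
qed

section \<open>Energy identities\<close>

text \<open>For \<phi> = u the two terms containing \<open>uxx\<close> are the integral of u ux uxx
  with opposite signs, so only the term with \<kappa> survives. Moving one derivative from
  \<open>deriv (deriv \<phi>)\<close> to \<open>ut\<close> leaves just \<phi> and its first
  derivative, which is why approximating \<open>u\<close> in H^1 is enough.\<close>

lemma momentum_energy_identity:
  assumes "weak_deriv u ux" "L2_mem ux" "L2_mem uxx" "weak_deriv ut utx" "L2_mem utx"
    and "continuous_on {0..1/2} u" "u 0 = 0" "u (1/2) = 0" "continuous_on {0..1/2} \<rho>"
    and pde: "\<And>\<phi>. test_fun \<phi> \<Longrightarrow> - L2_ip ut (deriv (deriv \<phi>))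
      = - L2_ip (\<lambda>x. u x * uxx x) (deriv \<phi>) + L2_ip (\<lambda>x. ux x * uxx x) \<phi>
        + \<kappa> / 2 * L2_ip (\<lambda>x. (\<rho> x)^2) (deriv \<phi>)"
  shows "L2_ip utx ux = \<kappa> / 2 * L2_ip (\<lambda>x. (\<rho> x)^2) ux"
proof -
  let ?K = "L2_norm utx + L2_norm (\<lambda>x. u x * uxx x) + \<bar>\<kappa> / 2\<bar> * L2_norm (\<lambda>x. (\<rho> x)^2)
    + L2_norm ux * L2_norm uxx"
  have Luu: "L2_mem (\<lambda>x. u x * uxx x)" by (intro L2_mem_continuous_mult assms)
  have Lr: "L2_mem (\<lambda>x. (\<rho> x)^2)" by (rule L2_mem_continuous) (intro continuous_intros assms)
  have bound: "\<bar>L2_ip utx ux - \<kappa> / 2 * L2_ip (\<lambda>x. (\<rho> x)^2) ux\<bar> \<le> e * ?K" if e: "e > 0" for e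
  proof -
    obtain \<phi> where phi: "test_fun \<phi>" "L2_norm (\<lambda>x. ux x - deriv \<phi> x) < e"
      "\<And>x. x \<in> {0..1/2} \<Longrightarrow> \<bar>u x - \<phi> x\<bar> \<le> e"
      using test_fun_dense_H10[OF assms(1,6,2,7,8) e] by blast
    note Ld = test_fun_L2[OF test_fun_deriv[OF phi(1)]]
    have cphi: "continuous_on {0..1/2} \<phi>" using phi(1) by (rule test_fun_continuous_on)
    let ?d = "\<lambda>x. ux x - deriv \<phi> x"
    \<comment> \<open>The product \<open>ux * uxx\<close> is only known to be integrable, so
      Cauchy-Schwarz cannot split it from u - \<phi>. The uniformly small factor is attached to
      \<open>ux\<close> instead, and the result is paired with \<open>uxx\<close>.\<close>
    let ?w = "\<lambda>x. (u x - \<phi> x) * ux x"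
    have Ldd: "L2_mem ?d" by (intro L2_mem_diff assms Ld)
    have cw: "continuous_on {0..1/2} (\<lambda>x. u x - \<phi> x)" by (intro continuous_intros assms cphi)
    have Lw: "L2_mem ?w" by (intro L2_mem_continuous_mult assms cw)
    have "- L2_ip ut (deriv (deriv \<phi>)) = L2_ip utx (deriv \<phi>)"
      using assms(4) test_fun_deriv[OF phi(1)] by (simp add: weak_deriv_iff)
    then have eq: "L2_ip utx (deriv \<phi>) = - L2_ip (\<lambda>x. u x * uxx x) (deriv \<phi>)
        + L2_ip (\<lambda>x. ux x * uxx x) \<phi> + \<kappa> / 2 * L2_ip (\<lambda>x. (\<rho> x)^2) (deriv \<phi>)"
      using pde[OF phi(1)] by simp
    have "L2_ip ?w uxx = L2_ip (\<lambda>x. u x * ux x) uxx - L2_ip (\<lambda>x. \<phi> x * ux x) uxx"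
      using L2_ip_diff_left[OF L2_mem_continuous_mult[OF assms(6,2)] L2_mem_continuous_mult[OF cphi assms(2)] assms(3)]
      by (simp add: left_diff_distrib)
    also have "L2_ip (\<lambda>x. u x * ux x) uxx = L2_ip (\<lambda>x. u x * uxx x) ux"
      by (rule L2_ip_cong) simp
    also have "L2_ip (\<lambda>x. \<phi> x * ux x) uxx = L2_ip (\<lambda>x. ux x * uxx x) \<phi>"
      by (rule L2_ip_cong) simp
    finally have w: "L2_ip (\<lambda>x. ux x * uxx x) \<phi> = L2_ip (\<lambda>x. u x * uxx x) ux - L2_ip ?w uxx"
      by simp
    have split: "L2_ip utx ux - \<kappa> / 2 * L2_ip (\<lambda>x. (\<rho> x)^2) ux
        = L2_ip utx ?d + L2_ip (\<lambda>x. u x * uxx x) ?d - \<kappa> / 2 * L2_ip (\<lambda>x. (\<rho> x)^2) ?d - L2_ip ?w uxx"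
      using eq w assms(2,5) Ld Luu Lr by (simp add: L2_ip_diff_right right_diff_distrib)
    have "\<bar>L2_ip utx ux - \<kappa> / 2 * L2_ip (\<lambda>x. (\<rho> x)^2) ux\<bar> \<le> \<bar>L2_ip utx ?d\<bar> + \<bar>L2_ip (\<lambda>x. u x * uxx x) ?d\<bar>
        + \<bar>\<kappa> / 2\<bar> * \<bar>L2_ip (\<lambda>x. (\<rho> x)^2) ?d\<bar> + \<bar>L2_ip ?w uxx\<bar>"
      unfolding split abs_mult[symmetric] by linarith
    also have "\<dots> \<le> L2_norm utx * e + L2_norm (\<lambda>x. u x * uxx x) * e
        + \<bar>\<kappa> / 2\<bar> * (L2_norm (\<lambda>x. (\<rho> x)^2) * e) + e * L2_norm ux * L2_norm uxx"
    proof -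
      have *: "\<bar>L2_ip h ?d\<bar> \<le> L2_norm h * e" if "L2_mem h" for h
        by (rule order_trans[OF L2_Cauchy_Schwarz[OF that Ldd]])
          (rule mult_left_mono[OF less_imp_le[OF phi(2)] L2_norm_nonneg])
      have "L2_norm ?w \<le> e * L2_norm ux"
        using phi(3) e assms(2) continuous_on_imp_set_borel_measurable_Ival[OF cw]
        by (intro L2_norm_bounded_mult) (auto dest: Ival_closed)
      then have w: "\<bar>L2_ip ?w uxx\<bar> \<le> e * L2_norm ux * L2_norm uxx"
        by (intro order_trans[OF L2_Cauchy_Schwarz[OF Lw assms(3)]] mult_right_mono) simp_all
      show ?thesis
        by (intro add_mono mult_left_mono[of _ _ "\<bar>\<kappa> / 2\<bar>"] * w assms(5) Luu Lr) simp
    qed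
    finally show ?thesis by (simp add: algebra_simps)
  qed
  then have "L2_ip utx ux - \<kappa> / 2 * L2_ip (\<lambda>x. (\<rho> x)^2) ux = 0"
    by (rule abs_le_all_multiples_imp_zero)
  then show ?thesis by simp
qed

text \<open>Integration by parts in \<open>\<rho> u \<rho>x\<close> is obtained by testing the weak derivative of \<open>u\<close> against
  \<open>\<phi>\<^sup>2\<close>, where \<open>\<phi>\<close> approximates \<open>\<rho>\<close> in \<open>H\<^sup>1\<close>.\<close>

lemma density_energy_identity:
  assumes "weak_deriv u ux" "L2_mem ux" "weak_deriv \<rho> \<rho>x" "L2_mem \<rho>x" "L2_mem rt"
    and "continuous_on {0..1/2} u"
    and "continuous_on {0..1/2} \<rho>" "\<rho> 0 = 0" "\<rho> (1/2) = 0"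
    and pde: "\<And>\<phi>. test_fun \<phi> \<Longrightarrow> L2_ip rt \<phi> = L2_ip (\<lambda>x. \<rho> x * u x) (deriv \<phi>)"
  shows "L2_ip rt \<rho> = - 1 / 2 * L2_ip (\<lambda>x. (\<rho> x)^2) ux"
proof -
  obtain B where B: "0 \<le> B" "\<And>x. x \<in> {0..1/2} \<Longrightarrow> \<bar>\<rho> x\<bar> \<le> B"
    using continuous_on_bounded_Ival[OF assms(7)] by blast
  note Lu = L2_mem_continuous[OF assms(6)] and Lr = L2_mem_continuous[OF assms(7)]
  have Lru: "L2_mem (\<lambda>x. \<rho> x * u x)" by (intro L2_mem_continuous_mult assms Lu)
  have Lr2: "L2_mem (\<lambda>x. (\<rho> x)^2)" by (rule L2_mem_continuous) (intro continuous_intros assms)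
  \<comment> \<open>For e \<le> 1 the norm of \<phi>' is at most that of \<open>\<rho>x\<close> plus
    1, and \<bar>\<rho> + \<phi>\<bar> is at most 2 B + 1; these are the constants in the second and
    third summand.\<close>
  let ?K = "L2_norm rt + L2_norm u * (L2_norm \<rho>x + 1) + 1 / 2 * ((2 * B + 1) * L2_norm ux)"
  have bound: "\<bar>L2_ip rt \<rho> + 1 / 2 * L2_ip (\<lambda>x. (\<rho> x)^2) ux\<bar> \<le> e * ?K" if e: "0 < e" "e \<le> 1" for e
  proof -
    obtain \<phi> where phi: "test_fun \<phi>" "L2_norm (\<lambda>x. \<rho>x x - deriv \<phi> x) < e"
      "\<And>x. x \<in> {0..1/2} \<Longrightarrow> \<bar>\<rho> x - \<phi> x\<bar> \<le> e"
      using test_fun_dense_H10[OF assms(3,7,4,8,9) e(1)] by blast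
    note Lp = test_fun_L2[OF phi(1)] and Ld = test_fun_L2[OF test_fun_deriv[OF phi(1)]]
    have cphi: "continuous_on {0..1/2} \<phi>" using phi(1) by (rule test_fun_continuous_on)
    let ?w = "\<lambda>x. \<rho> x - \<phi> x"
    have cw: "continuous_on {0..1/2} ?w" by (intro continuous_intros assms cphi)
    have Lw: "L2_mem ?w" using cw by (rule L2_mem_continuous)
    have Lwu: "L2_mem (\<lambda>x. ?w x * u x)" by (intro L2_mem_continuous_mult cw Lu)
    have cphi2: "continuous_on {0..1/2} (\<lambda>x. (\<phi> x)^2)" by (intro continuous_intros cphi)
    have Lp2: "L2_mem (\<lambda>x. (\<phi> x)^2)" using cphi2 by (rule L2_mem_continuous)
    have t2: "test_fun (\<lambda>x. \<phi> x * \<phi> x)"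
      by (intro test_fun_mult_smooth test_fun_smooth phi)
    have "deriv (\<lambda>x. \<phi> x * \<phi> x) = (\<lambda>x. 2 * (\<phi> x * deriv \<phi> x))"
    proof
      fix x
      show "deriv (\<lambda>x. \<phi> x * \<phi> x) x = 2 * (\<phi> x * deriv \<phi> x)"
        by (rule DERIV_imp_deriv) (auto intro!: derivative_eq_intros test_fun_DERIV[OF phi(1)])
    qed
    then have "L2_ip u (\<lambda>x. 2 * (\<phi> x * deriv \<phi> x)) = - L2_ip ux (\<lambda>x. \<phi> x * \<phi> x)"
      using assms(1) t2 unfolding weak_deriv_iff by metis
    then have "2 * L2_ip u (\<lambda>x. \<phi> x * deriv \<phi> x) = - L2_ip ux (\<lambda>x. \<phi> x * \<phi> x)"
      by (simp only: L2_ip_cmult_right)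
    moreover have "L2_ip u (\<lambda>x. \<phi> x * deriv \<phi> x) = L2_ip (\<lambda>x. \<phi> x * u x) (deriv \<phi>)"
      by (rule L2_ip_cong) simp
    moreover have "L2_ip ux (\<lambda>x. \<phi> x * \<phi> x) = L2_ip (\<lambda>x. (\<phi> x)^2) ux"
      by (rule L2_ip_cong) (simp add: power2_eq_square)
    ultimately have parts: "L2_ip (\<lambda>x. \<phi> x * u x) (deriv \<phi>) = - 1 / 2 * L2_ip (\<lambda>x. (\<phi> x)^2) ux"
      by simp
    \<comment> \<open>The equation tested with \<phi> still carries the factor \<rho>. It has to be
      exchanged for \<phi>, because integration by parts is exact only for \<phi> u \<phi>' = u
      (\<phi>^2)'/2.\<close>
    have w1: "L2_ip (\<lambda>x. ?w x * u x) (deriv \<phi>)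
        = L2_ip (\<lambda>x. \<rho> x * u x) (deriv \<phi>) - L2_ip (\<lambda>x. \<phi> x * u x) (deriv \<phi>)"
      using L2_ip_diff_left[OF Lru L2_mem_continuous_mult[OF cphi Lu] Ld]
      by (simp add: left_diff_distrib)
    have w2: "L2_ip (\<lambda>x. (\<rho> x)^2 - (\<phi> x)^2) ux = L2_ip (\<lambda>x. (\<rho> x)^2) ux - L2_ip (\<lambda>x. (\<phi> x)^2) ux"
      using Lr2 Lp2 assms(2) by (rule L2_ip_diff_left)
    have w3: "L2_ip rt ?w = L2_ip rt \<rho> - L2_ip rt \<phi>"
      using Lr Lp assms(5) by (rule L2_ip_diff_right)
    have split: "L2_ip rt \<rho> + 1 / 2 * L2_ip (\<lambda>x. (\<rho> x)^2) ux
        = L2_ip rt ?w + L2_ip (\<lambda>x. ?w x * u x) (deriv \<phi>) + 1 / 2 * L2_ip (\<lambda>x. (\<rho> x)^2 - (\<phi> x)^2) ux"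
      using pde[OF phi(1)] parts w1 w2 w3 by linarith
    have "\<bar>L2_ip rt \<rho> + 1 / 2 * L2_ip (\<lambda>x. (\<rho> x)^2) ux\<bar> \<le> \<bar>L2_ip rt ?w\<bar> + \<bar>L2_ip (\<lambda>x. ?w x * u x) (deriv \<phi>)\<bar>
        + 1 / 2 * \<bar>L2_ip (\<lambda>x. (\<rho> x)^2 - (\<phi> x)^2) ux\<bar>"
      unfolding split by linarith
    also have "\<dots> \<le> L2_norm rt * e + (e * L2_norm u) * (L2_norm \<rho>x + 1)
        + 1 / 2 * ((e * (2 * B + 1)) * L2_norm ux)"
    proof (intro add_mono mult_left_mono)
      have "L2_norm ?w \<le> e"
        using phi(3) e continuous_on_imp_set_borel_measurable_Ival[OF cw]
        by (intro L2_norm_bounded) (auto dest: Ival_closed)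
      then show "\<bar>L2_ip rt ?w\<bar> \<le> L2_norm rt * e"
        by (intro order_trans[OF L2_Cauchy_Schwarz[OF assms(5) Lw]] mult_left_mono) simp_all
      have 1: "L2_norm (\<lambda>x. ?w x * u x) \<le> e * L2_norm u"
        using phi(3) e continuous_on_imp_set_borel_measurable_Ival[OF cw] Lu
        by (intro L2_norm_bounded_mult) (auto dest: Ival_closed)
      have "L2_norm (deriv \<phi>) \<le> L2_norm (\<lambda>x. deriv \<phi> x - \<rho>x x) + L2_norm \<rho>x"
        using L2_norm_triangle[OF L2_mem_diff[OF Ld assms(4)] assms(4)] by simp
      then have 2: "L2_norm (deriv \<phi>) \<le> L2_norm \<rho>x + 1"
        using phi(2) e L2_norm_minus_commute[of "deriv \<phi>" \<rho>x] by simp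
      have "\<bar>L2_ip (\<lambda>x. ?w x * u x) (deriv \<phi>)\<bar> \<le> L2_norm (\<lambda>x. ?w x * u x) * L2_norm (deriv \<phi>)"
        by (rule L2_Cauchy_Schwarz[OF Lwu Ld])
      also have "\<dots> \<le> (e * L2_norm u) * (L2_norm \<rho>x + 1)"
        using e by (intro mult_mono 1 2) auto
      finally show "\<bar>L2_ip (\<lambda>x. ?w x * u x) (deriv \<phi>)\<bar> \<le> (e * L2_norm u) * (L2_norm \<rho>x + 1)" .
      have "L2_norm (\<lambda>x. (\<rho> x)^2 - (\<phi> x)^2) \<le> e * (2 * B + 1)"
      proof (rule L2_norm_bounded)
        show "set_borel_measurable lborel Ival (\<lambda>x. (\<rho> x)^2 - (\<phi> x)^2)"
          by (intro continuous_on_imp_set_borel_measurable_Ival continuous_intros assms cphi)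
        show "\<bar>(\<rho> x)^2 - (\<phi> x)^2\<bar> \<le> e * (2 * B + 1)" if "x \<in> Ival" for x
        proof -
          note x = Ival_closed[OF that]
          have "\<bar>\<rho> x + \<phi> x\<bar> \<le> 2 * B + 1" using phi(3)[OF x] B(2)[OF x] e by linarith
          then have "\<bar>?w x\<bar> * \<bar>\<rho> x + \<phi> x\<bar> \<le> e * (2 * B + 1)"
            using phi(3)[OF x] e by (intro mult_mono) auto
          moreover have "(\<rho> x)^2 - (\<phi> x)^2 = ?w x * (\<rho> x + \<phi> x)"
            by (simp add: power2_eq_square algebra_simps)
          ultimately show ?thesis by (simp add: abs_mult)
        qed
      qed (use e B in auto)
      then show "\<bar>L2_ip (\<lambda>x. (\<rho> x)^2 - (\<phi> x)^2) ux\<bar> \<le> (e * (2 * B + 1)) * L2_norm ux"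
        by (intro order_trans[OF L2_Cauchy_Schwarz[OF L2_mem_diff[OF Lr2 Lp2] assms(2)]] mult_right_mono)
          simp_all
    qed simp
    also have "\<dots> = e * ?K" by (simp add: algebra_simps)
    finally show ?thesis .
  qed
  then have "L2_ip rt \<rho> + 1 / 2 * L2_ip (\<lambda>x. (\<rho> x)^2) ux = 0"
    by (rule abs_le_all_multiples_imp_zero)
  then show ?thesis by simp
qed

text \<open>Write h = \<tau> - t and let q be the difference quotient, so that a(\<tau>) = a(t) + h
  q. Expanding the square gives 2 <a(t), q> + h |q|^2 for the quotient of the squared norms. Since q
  tends to b in L2, the first term tends to 2 <a(t), b> and the second to 0.\<close>

lemma L2_norm_sq_has_derivative:
  assumes mem: "\<And>\<tau>. \<tau> \<in> S \<Longrightarrow> L2_mem (a \<tau>)" and "L2_mem b" "t \<in> S"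
    and lim: "((\<lambda>\<tau>. L2_norm (\<lambda>x. (a \<tau> x - a t x) / (\<tau> - t) - b x)) \<longlongrightarrow> 0) (at t within S)"
  shows "((\<lambda>\<tau>. (L2_norm (a \<tau>))^2) has_real_derivative 2 * L2_ip (a t) b) (at t within S)"
proof -
  define r where "r \<tau> = (\<lambda>x. (a \<tau> x - a t x) / (\<tau> - t) - b x)" for \<tau>
  have r0: "((\<lambda>\<tau>. L2_norm (r \<tau>)) \<longlongrightarrow> 0) (at t within S)"
    using lim by (simp add: r_def)
  have "\<forall>\<^sub>F \<tau> in at t within S. \<tau> \<in> S \<and> \<tau> \<noteq> t"
    by (simp add: eventually_at_filter)
  then have "\<forall>\<^sub>F \<tau> in at t within S.
      norm (((L2_norm (a \<tau>))^2 - (L2_norm (a t))^2) / (\<tau> - t) - 2 * L2_ip (a t) b)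
      \<le> 2 * (L2_norm (a t) * L2_norm (r \<tau>)) + \<bar>\<tau> - t\<bar> * (L2_norm b + L2_norm (r \<tau>))^2"
  proof eventually_elim
    case (elim \<tau>)
    define h where "h = \<tau> - t"
    have h: "h \<noteq> 0" using elim by (simp add: h_def)
    note Lt = mem[OF assms(3)]
    have Lr: "L2_mem (r \<tau>)"
    proof -
      have "L2_mem (\<lambda>x. (1 / h) * (a \<tau> x - a t x) - b x)"
        using elim by (intro L2_mem_diff L2_mem_cmult mem assms) auto
      then show ?thesis by (simp add: r_def h_def)
    qed
    define q where "q x = b x + r \<tau> x" for x
    have Lq: "L2_mem q" unfolding q_def by (intro L2_mem_add assms Lr)
    have "a \<tau> = (\<lambda>x. a t x + h * q x)"
      using h by (auto simp: q_def r_def h_def)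
    then have "(L2_norm (a \<tau>))^2 = (L2_norm (a t))^2 + 2 * h * L2_ip (a t) q + h^2 * (L2_norm q)^2"
      using Lt Lq L2_mem_cmult[OF Lq, of h]
      unfolding L2_norm_sq
      by (simp add: L2_ip_add_left L2_ip_add_right L2_mem_add L2_ip_cmult_left
          L2_ip_cmult_right L2_ip_commute[of q "a t"] power2_eq_square algebra_simps)
    then have "((L2_norm (a \<tau>))^2 - (L2_norm (a t))^2) / h = 2 * L2_ip (a t) q + h * (L2_norm q)^2"
      using h by (simp add: field_simps power2_eq_square)
    also have "L2_ip (a t) q = L2_ip (a t) b + L2_ip (a t) (r \<tau>)"
      unfolding q_def using assms(2) Lr Lt by (rule L2_ip_add_right)
    finally have split: "((L2_norm (a \<tau>))^2 - (L2_norm (a t))^2) / h - 2 * L2_ip (a t) b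
        = 2 * L2_ip (a t) (r \<tau>) + h * (L2_norm q)^2"
      by simp
    have "\<bar>((L2_norm (a \<tau>))^2 - (L2_norm (a t))^2) / h - 2 * L2_ip (a t) b\<bar>
        \<le> 2 * \<bar>L2_ip (a t) (r \<tau>)\<bar> + \<bar>h\<bar> * (L2_norm q)^2"
      unfolding split using abs_triangle_ineq[of "2 * L2_ip (a t) (r \<tau>)" "h * (L2_norm q)^2"]
      by (simp add: abs_mult)
    also have "\<dots> \<le> 2 * (L2_norm (a t) * L2_norm (r \<tau>)) + \<bar>h\<bar> * (L2_norm b + L2_norm (r \<tau>))^2"
      unfolding q_def
      by (intro add_mono mult_left_mono power_mono L2_Cauchy_Schwarz L2_norm_triangle Lt Lr assms(2)) auto
    finally show ?case by (simp add: h_def)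
  qed
  moreover have "((\<lambda>\<tau>. 2 * (L2_norm (a t) * L2_norm (r \<tau>)) + \<bar>\<tau> - t\<bar> * (L2_norm b + L2_norm (r \<tau>))^2)
      \<longlongrightarrow> 0) (at t within S)"
    by (rule tendsto_eq_intros r0 refl | simp)+
  ultimately have "((\<lambda>\<tau>. ((L2_norm (a \<tau>))^2 - (L2_norm (a t))^2) / (\<tau> - t) - 2 * L2_ip (a t) b)
      \<longlongrightarrow> 0) (at t within S)"
    by (rule Lim_null_comparison)
  then show ?thesis by (simp add: has_field_derivative_iff LIM_zero_iff)
qed

section \<open>Conservation of energy\<close>

text \<open>The derivative \<open>ux\<close> is the one that \<open>pde_at\<close> provides, while
  \<open>utx\<close> stays arbitrary: it is picked only when the energy is differentiated at a given
  time.\<close>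

lemma pde_at_energy:
  assumes "pde_at \<kappa> u \<rho> ut rt"
    and "continuous_on {0..1/2} u" "u 0 = 0" "u (1/2) = 0"
    and "continuous_on {0..1/2} \<rho>" "\<rho> 0 = 0" "\<rho> (1/2) = 0"
    and "weak_deriv \<rho> \<rho>x" "L2_mem \<rho>x" "L2_mem rt"
  obtains ux where "L2_mem ux" "weak_deriv u ux"
    "\<And>utx. weak_deriv ut utx \<Longrightarrow> L2_mem utx \<Longrightarrow> L2_ip ux utx + \<kappa> * L2_ip \<rho> rt = 0"
proof -
  from assms(1) obtain ux uxx where
      w: "L2_mem ux" "L2_mem uxx" "weak_deriv u ux"
    and p1: "\<And>\<phi>. test_fun \<phi> \<Longrightarrow> - L2_ip ut (deriv (deriv \<phi>))
      = - L2_ip (\<lambda>x. u x * uxx x) (deriv \<phi>) + L2_ip (\<lambda>x. ux x * uxx x) \<phi>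
        + \<kappa> / 2 * L2_ip (\<lambda>x. (\<rho> x)^2) (deriv \<phi>)"
    and p2: "\<And>\<phi>. test_fun \<phi> \<Longrightarrow> L2_ip rt \<phi> = L2_ip (\<lambda>x. \<rho> x * u x) (deriv \<phi>)"
    unfolding pde_at_def L2_ip_def by blast
  have "L2_ip ux utx + \<kappa> * L2_ip \<rho> rt = 0" if "weak_deriv ut utx" "L2_mem utx" for utx
  proof -
    have "L2_ip utx ux = \<kappa> / 2 * L2_ip (\<lambda>x. (\<rho> x)^2) ux"
      by (rule momentum_energy_identity[OF w(3,1,2) that assms(2-5) p1])
    moreover have "L2_ip rt \<rho> = - 1 / 2 * L2_ip (\<lambda>x. (\<rho> x)^2) ux"
      by (rule density_energy_identity[OF w(3,1) assms(8-10,2,5-7) p2])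
    ultimately show ?thesis by (simp add: L2_ip_commute[of ux] L2_ip_commute[of \<rho>])
  qed
  with w show ?thesis using that by blast
qed

lemma H_mem_difference_quotient:
  assumes "H_mem r f" "H_mem r g" "H_mem r k"
  shows "H_mem r (\<lambda>x. (f x - g x) / h - k x)"
  using H_mem_lincomb[OF H_mem_lincomb[OF assms(1,2), of "1 / h" "- 1 / h"] assms(3), of 1 "-1"]
  by (simp add: diff_divide_distrib)

lemma weak_deriv_difference_quotient:
  assumes "weak_deriv f f'" "weak_deriv g g'" "weak_deriv k k'"
    and "L2_mem f" "L2_mem g" "L2_mem k" "L2_mem f'" "L2_mem g'" "L2_mem k'"
  shows "weak_deriv (\<lambda>x. (f x - g x) / h - k x) (\<lambda>x. (f' x - g' x) / h - k' x)"
proof -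
  have "weak_deriv (\<lambda>x. (1 / h) * (f x - g x) - k x) (\<lambda>x. (1 / h) * (f' x - g' x) - k' x)"
    by (intro weak_deriv_diff weak_deriv_cmult L2_mem_cmult L2_mem_diff assms)
  then show ?thesis by simp
qed

lemma is_sol_energy_conserved:
  assumes "2 \<le> s" "s < 5/2" "is_sol \<kappa> s u0 \<rho>0 T u \<rho>"
  obtains ux E where "\<And>t. t \<in> tint T \<Longrightarrow> L2_mem (ux t)" "\<And>t. t \<in> tint T \<Longrightarrow> weak_deriv (u t) (ux t)"
    "\<And>t. t \<in> tint T \<Longrightarrow> (L2_norm (ux t))^2 + \<kappa> * (L2_norm (\<rho> t))^2 = E"
proof -
  from assms(3) have sol: "\<And>t. t \<in> tint T \<Longrightarrow> continuous_on {0..1/2} (u t) \<and> continuous_on {0..1/2} (\<rho> t) \<and>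
        u t 0 = 0 \<and> u t (1/2) = 0 \<and> \<rho> t 0 = 0 \<and> \<rho> t (1/2) = 0 \<and>
        H_mem s (u t) \<and> H_mem (s - 1) (\<rho> t)"
    unfolding is_sol_def by blast
  from assms(3) obtain ut rt where der: "\<And>t. t \<in> tint T \<Longrightarrow>
        H_mem (s - 1) (ut t) \<and> H_mem (s - 2) (rt t) \<and>
        ((\<lambda>\<tau>. H_norm (s - 1) (\<lambda>x. (u \<tau> x - u t x) / (\<tau> - t) - ut t x)) \<longlongrightarrow> 0) (at t within tint T) \<and>
        ((\<lambda>\<tau>. H_norm (s - 2) (\<lambda>x. (\<rho> \<tau> x - \<rho> t x) / (\<tau> - t) - rt t x)) \<longlongrightarrow> 0) (at t within tint T) \<and>
        pde_at \<kappa> (u t) (\<rho> t) (ut t) (rt t)"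
    unfolding is_sol_def by blast
  \<comment> \<open>Both fractional parts equal s - 2, which is below 1/2 as
    \<open>H_mem_pred\<close> requires.\<close>
  have "\<lfloor>s\<rfloor> = 2" using assms(1,2) by linarith
  then have frac: "frac s < 1/2" "frac (s - 1) < 1/2" using assms(2) by (auto simp: frac_def)
  have memu: "H_mem (s - 1) (u t)" and memr: "H_mem (s - 2) (\<rho> t)" if "t \<in> tint T" for t
    using H_mem_pred[of s "u t"] H_mem_pred[of "s - 1" "\<rho> t"] sol[OF that] assms(1) frac by auto
  have "\<exists>ux. L2_mem ux \<and> weak_deriv (u t) ux \<and>
      (\<forall>utx. weak_deriv (ut t) utx \<longrightarrow> L2_mem utx \<longrightarrow> L2_ip ux utx + \<kappa> * L2_ip (\<rho> t) (rt t) = 0)"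
    if t: "t \<in> tint T" for t
  proof -
    obtain \<rho>x where "L2_mem \<rho>x" "weak_deriv (\<rho> t) \<rho>x"
      using H_mem_weak_deriv[of "s - 1" "\<rho> t"] sol[OF t] assms(1) by auto
    moreover have "L2_mem (rt t)" using der[OF t] by (blast intro: L2_mem_H_mem)
    ultimately obtain ux where "L2_mem ux" "weak_deriv (u t) ux"
        "\<And>utx. weak_deriv (ut t) utx \<Longrightarrow> L2_mem utx \<Longrightarrow> L2_ip ux utx + \<kappa> * L2_ip (\<rho> t) (rt t) = 0"
      using pde_at_energy[of \<kappa> "u t" "\<rho> t" "ut t" "rt t" \<rho>x] sol[OF t] der[OF t] by metis
    then show ?thesis by blast
  qed
  \<comment> \<open>One choice of \<open>ux\<close> for all times at once, since the energy compares
    different times.\<close>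
  then obtain ux where ux: "\<And>t. t \<in> tint T \<Longrightarrow> L2_mem (ux t)"
      "\<And>t. t \<in> tint T \<Longrightarrow> weak_deriv (u t) (ux t)"
    and cancel: "\<And>t utx. t \<in> tint T \<Longrightarrow> weak_deriv (ut t) utx \<Longrightarrow> L2_mem utx \<Longrightarrow>
        L2_ip (ux t) utx + \<kappa> * L2_ip (\<rho> t) (rt t) = 0"
    by metis
  let ?E = "\<lambda>t. (L2_norm (ux t))^2 + \<kappa> * (L2_norm (\<rho> t))^2"
  have "(?E has_field_derivative 0) (at t within tint T)" if t: "t \<in> tint T" for t
  proof -
    note d = der[OF t]
    obtain utx where utx: "L2_mem utx" "weak_deriv (ut t) utx"
      using H_mem_weak_deriv[of "s - 1" "ut t"] d assms(1) by auto
    have ev: "\<forall>\<^sub>F \<tau> in at t within tint T. \<tau> \<in> tint T"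
      by (simp add: eventually_at_filter)
    \<comment> \<open>As s - 1 \<ge> 1, the norm in which \<open>u\<close> is differentiable in time
      also controls the first weak derivative of the remainder; hence \<open>ux\<close> is
      differentiable in L2 with derivative \<open>utx\<close>.\<close>
    have "((\<lambda>\<tau>. L2_norm (\<lambda>x. (ux \<tau> x - ux t x) / (\<tau> - t) - utx x)) \<longlongrightarrow> 0) (at t within tint T)"
    proof (rule tendsto_sandwich[OF _ _ tendsto_const])
      show "((\<lambda>\<tau>. H_norm (s - 1) (\<lambda>x. (u \<tau> x - u t x) / (\<tau> - t) - ut t x)) \<longlongrightarrow> 0) (at t within tint T)"
        using d by blast
      show "\<forall>\<^sub>F \<tau> in at t within tint T. L2_norm (\<lambda>x. (ux \<tau> x - ux t x) / (\<tau> - t) - utx x)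
          \<le> H_norm (s - 1) (\<lambda>x. (u \<tau> x - u t x) / (\<tau> - t) - ut t x)"
        using ev
      proof eventually_elim
        case (elim \<tau>)
        have "L2_mem (\<lambda>x. (1 / (\<tau> - t)) * (ux \<tau> x - ux t x) - utx x)"
          by (intro L2_mem_diff L2_mem_cmult ux elim t utx)
        then have "L2_mem (\<lambda>x. (ux \<tau> x - ux t x) / (\<tau> - t) - utx x)" by simp
        moreover have "weak_deriv (\<lambda>x. (u \<tau> x - u t x) / (\<tau> - t) - ut t x)
            (\<lambda>x. (ux \<tau> x - ux t x) / (\<tau> - t) - utx x)"
          using d by (intro weak_deriv_difference_quotient ux utx elim t L2_mem_H_mem[OF memu] L2_mem_H_mem[of _ "ut t"]) auto
        moreover have "H_mem (s - 1) (\<lambda>x. (u \<tau> x - u t x) / (\<tau> - t) - ut t x)"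
          using d by (intro H_mem_difference_quotient memu elim t) auto
        ultimately show ?case
          using assms(1) by (intro L2_norm_weak_deriv_le_H_norm) auto
      qed
    qed simp
    then have 1: "((\<lambda>\<tau>. (L2_norm (ux \<tau>))^2) has_real_derivative 2 * L2_ip (ux t) utx) (at t within tint T)"
      using ux(1) utx(1) t by (intro L2_norm_sq_has_derivative)
    have "((\<lambda>\<tau>. L2_norm (\<lambda>x. (\<rho> \<tau> x - \<rho> t x) / (\<tau> - t) - rt t x)) \<longlongrightarrow> 0) (at t within tint T)"
    proof (rule tendsto_sandwich[OF _ _ tendsto_const])
      show "((\<lambda>\<tau>. H_norm (s - 2) (\<lambda>x. (\<rho> \<tau> x - \<rho> t x) / (\<tau> - t) - rt t x)) \<longlongrightarrow> 0) (at t within tint T)"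
        using d by blast
      show "\<forall>\<^sub>F \<tau> in at t within tint T. L2_norm (\<lambda>x. (\<rho> \<tau> x - \<rho> t x) / (\<tau> - t) - rt t x)
          \<le> H_norm (s - 2) (\<lambda>x. (\<rho> \<tau> x - \<rho> t x) / (\<tau> - t) - rt t x)"
        using ev
      proof eventually_elim
        case (elim \<tau>)
        show ?case
          using d by (intro L2_norm_le_H_norm H_mem_difference_quotient memr elim t) auto
      qed
    qed simp
    moreover have "L2_mem (rt t)" using d by (blast intro: L2_mem_H_mem)
    ultimately have 2: "((\<lambda>\<tau>. (L2_norm (\<rho> \<tau>))^2) has_real_derivative 2 * L2_ip (\<rho> t) (rt t)) (at t within tint T)"
      using L2_mem_H_mem[OF memr] t by (intro L2_norm_sq_has_derivative)
    have "(?E has_real_derivative 2 * L2_ip (ux t) utx + \<kappa> * (2 * L2_ip (\<rho> t) (rt t))) (at t within tint T)"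
      by (intro DERIV_add DERIV_cmult 1 2)
    moreover have "2 * L2_ip (ux t) utx + \<kappa> * (2 * L2_ip (\<rho> t) (rt t)) = 0"
      using cancel[OF t utx(2,1)] by (simp add: algebra_simps)
    ultimately show ?thesis by simp
  qed
  \<comment> \<open>A zero derivative forces constancy on a convex set. Taking it within
    \<open>tint T\<close> covers t = 0, where it is one-sided.\<close>
  moreover have "convex (tint T)"
  proof -
    have "is_interval (tint T)"
      unfolding is_interval_1 tint_def by auto (metis ereal_less_eq(3) le_less_trans)
    then show ?thesis by (rule is_interval_convex)
  qed
  ultimately obtain E where "\<And>t. t \<in> tint T \<Longrightarrow> ?E t = E"
    using has_field_derivative_zero_constant[of "tint T" ?E] by blast
  then show ?thesis using that ux by blast
qed

theorem theorem4p4: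
  fixes \<kappa> s :: real and u0 \<rho>0 :: "real \<Rightarrow> real" and T :: ereal
    and u \<rho> :: "real \<Rightarrow> real \<Rightarrow> real"
  assumes "\<kappa> > 0" and "2 \<le> s" and "s < 5/2"
    and "H_mem s u0" and "H_mem (s - 1) \<rho>0"
    and "continuous_on {0..1/2} u0" and "continuous_on {0..1/2} \<rho>0"
    and "u0 0 = 0" and "u0 (1/2) = 0" and "\<rho>0 0 = 0" and "\<rho>0 (1/2) = 0"
    and "is_max_sol \<kappa> s u0 \<rho>0 T u \<rho>"
  shows "\<forall>T'>0. \<exists>C. \<forall>t. 0 \<le> t \<and> ereal t < T \<and> t \<le> T' \<longrightarrow>
           H_norm 1 (u t) + L2_norm (\<rho> t) \<le> C"
proof -
  have sol: "is_sol \<kappa> s u0 \<rho>0 T u \<rho>" using assms(12) by (simp add: is_max_sol_def)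
  obtain ux E where ux: "\<And>t. t \<in> tint T \<Longrightarrow> L2_mem (ux t)"
      "\<And>t. t \<in> tint T \<Longrightarrow> weak_deriv (u t) (ux t)"
    and E: "\<And>t. t \<in> tint T \<Longrightarrow> (L2_norm (ux t))^2 + \<kappa> * (L2_norm (\<rho> t))^2 = E"
    using is_sol_energy_conserved[OF assms(2,3) sol] by blast
  \<comment> \<open>As \<kappa> > 0, each part of the energy is at most \<open>E\<close>. The H^1
    norm of u is at most twice the norm of \<open>ux\<close>, which explains the factor 2. The bound
    does not depend on t, so one constant serves every T'.\<close>
  have bound: "H_norm 1 (u t) + L2_norm (\<rho> t) \<le> 2 * sqrt E + sqrt (E / \<kappa>)" if t: "t \<in> tint T" for t
  proof -
    have cu: "continuous_on {0..1/2} (u t)" "u t 0 = 0" using sol t by (auto simp: is_sol_def)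
    have "\<bar>u t x\<bar> \<le> L2_norm (ux t)" if "x \<in> Ival" for x
      using weak_deriv_FTC[OF ux(2)[OF t] cu(1) ux(1)[OF t] Ival_closed[OF that]]
        L2_prim_abs_le[OF ux(1)[OF t], of x] cu(2) Ival_closed[OF that] by simp
    then have "L2_norm (u t) \<le> L2_norm (ux t)"
      using continuous_on_imp_set_borel_measurable_Ival[OF cu(1)] by (intro L2_norm_bounded) auto
    moreover have "H_norm 1 (u t) \<le> L2_norm (u t) + L2_norm (ux t)"
      by (rule H_norm_1_le[OF L2_mem_continuous[OF cu(1)] ux(2)[OF t] ux(1)[OF t]])
    moreover have "L2_norm (ux t) \<le> sqrt E"
      using E[OF t] assms(1) by (intro real_le_rsqrt) (smt (verit) mult_nonneg_nonneg zero_le_power2)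
    moreover have "L2_norm (\<rho> t) \<le> sqrt (E / \<kappa>)"
      using E[OF t, symmetric] assms(1) by (intro real_le_rsqrt) (simp add: field_simps)
    ultimately show ?thesis by linarith
  qed
  then show ?thesis by (auto simp: tint_def)
qed

end
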